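(* Let $d\ge1$, $\mu>-\frac12$, $\beta>-d$, $\gamma>-1$ with $2\mu+\beta+d>0$. For $\mathbf b\in\mathbb{B}^d$, $0<r<1$, and $(x,t)\in\mathbb{V}^{d+1}$, $$\sum_{n=0}^\infty\ \sum_{|\mathbf k|\le n}\frac{(-1)^{|\mathbf k|}(2\mu)_{|\mathbf k|}}{2^{|\mathbf k|}(\mu+\frac12)_{|\mathbf k|}\,\mathbf k!\,(n-|\mathbf k|)!}\,\mathsf{U}^{\mathsf J}_{\mathbf k,n}(x,t)\,\mathbf b^{\mathbf k}r^n=\frac{2^{2\mu+\beta+\gamma+d-1}R^{-1}(1+r+R)^{-\gamma}(1-r+R)^{2\mu-\beta-d+1}}{\Bigl(\bigl[(1-r+R)^2-4r\langle\mathbf b,x\rangle\bigr]^2+16r^2\|\mathbf b\|^2(t^2-\|x\|^2)\Bigr)^{\mu}},$$ where $R=\left[(1-r)^2+4rt\right]^{\frac12}$.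
   Context: $\mathbb{B}^d$ is the unit ball of $\mathbb{R}^d$; $\mathbb{V}^{d+1}=\{(x,t):\|x\|\le t,\ x\in\mathbb{R}^d,\ 0\le t\le1\}$; $W_{\beta,\gamma,\mu}(x,t)=(t^2-\|x\|^2)^{\mu-\frac12}t^\beta(1-t)^\gamma$. For $\mathbf k\in\mathbb{N}_0^d$: $|\mathbf k|=k_1+\cdots+k_d$, $\mathbf k!=k_1!\cdots k_d!$, $\mathbf b^{\mathbf k}=b_1^{k_1}\cdots b_d^{k_d}$; $(a)_k=a(a+1)\cdots(a+k-1)$. The inner sum runs over $\mathbf k\in\mathbb{N}_0^d$ with $|\mathbf k|\le n$. For $|\mathbf k|=k\le n$, $$\mathsf{U}^{\mathsf J}_{\mathbf k,n}(x,t)=\frac{1}{W_{\beta,\gamma,\mu}(x,t)}\,\frac{1}{t^{2k+2\mu+d-1}}\left[\frac{\partial^{\mathbf k}}{\partial x^{\mathbf k}}(t^2-\|x\|^2)^{k+\mu-\frac12}\right]\left[\frac{\partial^{n-k}}{\partial t^{n-k}}\bigl(t^{n+k+\beta+2\mu+d-1}(1-t)^{\gamma+n-k}\bigr)\right],$$ which is a polynomial in $(x,t)$. *)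

theory Defs
  imports "HOL-Analysis.Analysis"
begin

definition solid_cone :: "((real^'d::finite) \<times> real) set" where
  "solid_cone = {(x, t). norm x \<le> t \<and> 0 \<le> t \<and> t \<le> 1}"

definition cone_weight :: "real \<Rightarrow> real \<Rightarrow> real \<Rightarrow> (real^'d::finite) \<Rightarrow> real \<Rightarrow> real" where
  "cone_weight \<beta> \<gamma> \<mu> x t =
     (t\<^sup>2 - (norm x)\<^sup>2) powr (\<mu> - 1/2) * t powr \<beta> * (1 - t) powr \<gamma>"

definition mi_abs :: "('d::finite \<Rightarrow> nat) \<Rightarrow> nat" where
  "mi_abs k = (\<Sum>i\<in>UNIV. k i)"

definition mi_fact :: "('d::finite \<Rightarrow> nat) \<Rightarrow> real" where
  "mi_fact k = (\<Prod>i\<in>UNIV. fact (k i))"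

definition mi_power :: "(real^'d::finite) \<Rightarrow> ('d \<Rightarrow> nat) \<Rightarrow> real" where
  "mi_power b k = (\<Prod>i\<in>UNIV. (b $ i) ^ k i)"

definition partial_deriv ::
    "'d::finite \<Rightarrow> ((real^'d) \<Rightarrow> real) \<Rightarrow> (real^'d) \<Rightarrow> real" where
  "partial_deriv i f x = deriv (\<lambda>s. f (x + s *\<^sub>R axis i 1)) 0"

(* The coordinates are processed in an arbitrary fixed order (the index type
   carries no order). The operator is only used for functions and points where the
   function is smooth nearby, so the order is immaterial. *)
definition mixed_partial ::
    "('d::finite \<Rightarrow> nat) \<Rightarrow> ((real^'d) \<Rightarrow> real) \<Rightarrow> (real^'d) \<Rightarrow> real" where
  "mixed_partial k f =
     foldr (\<lambda>i. partial_deriv i ^^ k i) (SOME is. distinct is \<and> set is = UNIV) f"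

(* The Rodrigues expression; meaningful for norm x < t < 1. *)
definition UJ_formula ::
    "real \<Rightarrow> real \<Rightarrow> real \<Rightarrow> ('d::finite \<Rightarrow> nat) \<Rightarrow> nat \<Rightarrow> (real^'d) \<Rightarrow> real \<Rightarrow> real" where
  "UJ_formula \<beta> \<gamma> \<mu> k n x t =
     (let m = mi_abs k; d = real CARD('d) in
        1 / cone_weight \<beta> \<gamma> \<mu> x t
        * (1 / t powr (2 * real m + 2 * \<mu> + d - 1))
        * mixed_partial k (\<lambda>y. (t\<^sup>2 - (norm y)\<^sup>2) powr (real m + \<mu> - 1/2)) x
        * (deriv ^^ (n - m))
            (\<lambda>s. s powr (real n + real m + \<beta> + 2 * \<mu> + d - 1)
                 * (1 - s) powr (\<gamma> + real n - real m)) t)"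

(* On the boundary of the cone the Rodrigues expression is singular (division by
   zero), so U is taken to be the polynomial in (x, t) that it defines on the
   interior; a polynomial is determined by its values on this nonempty open set. *)
definition UJ ::
    "real \<Rightarrow> real \<Rightarrow> real \<Rightarrow> ('d::finite \<Rightarrow> nat) \<Rightarrow> nat \<Rightarrow> (real^'d) \<times> real \<Rightarrow> real" where
  "UJ \<beta> \<gamma> \<mu> k n =
     (THE p. real_polynomial_function p \<and>
        (\<forall>x t. norm x < t \<and> t < 1 \<longrightarrow> p (x, t) = UJ_formula \<beta> \<gamma> \<mu> k n x t))"

end

theory Submission
  imports Defs "HOL-Complex_Analysis.Complex_Analysis"
begin

text \<open>
  On the cone, \<open>U\<close> factors as a polynomial on the ball, coming from the derivatives in \<open>x\<close>, times the
  shifted Jacobi polynomial with parameter \<open>a + 2m\<close>, where \<open>a = 2\<mu> + \<beta> + d - 1\<close> and \<open>m = |k|\<close>.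
  Summed over all \<open>k\<close> with \<open>|k| = m\<close>, the ball factors give the \<open>m\<close>-th Taylor coefficient
  of \<open>((1 - cs)\<^sup>2 + Ds\<^sup>2) powr (-\<mu>)\<close> in \<open>s\<close>, with \<open>c = \<langle>b, x\<rangle>\<close> and \<open>D = |b|\<^sup>2(t\<^sup>2 - |x|\<^sup>2)\<close>.
  The Jacobi generating function with parameter \<open>a + 2m\<close> is the one with parameter \<open>a\<close> times the
  \<open>m\<close>-th power of \<open>4 / (1 - r + R)\<^sup>2\<close>; hence the sum over \<open>m\<close> is that Gegenbauer-type function evaluated
  at \<open>s = 4r / (1 - r + R)\<^sup>2\<close>. Convergence for all \<open>r < 1\<close> is not estimated termwise: the closed form
  extends holomorphically to the unit disc because \<open>|s|t < 1\<close> there, so its Taylor series converges.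
\<close>

subsection \<open>Shifted Jacobi polynomials\<close>

text \<open>The Jacobi generating function is a case of Lagrange inversion: the N-th shifted Jacobi
  polynomial is the coefficient of y^N in a fixed function times the N-th power of a quadratic
  \<psi>, and the small root of y = z \<psi>(y) is rational in z and R. This is where the factors 1
  - z + R and 1 + z + R come from. The bound |s| t < 1 is a half-plane statement: s t is the Cayley
  transform (R - (1 - z)) / (R + (1 - z)), so it follows from Re (R / (1 - z)) > 0.

  On the ball side, the sum over |k| = m is a coefficient of exp(-2 c Z X - |b|^2 Z X^2), where Z^L
  is to be read as an L-th derivative of a power of t^2 - |x|^2. That power has exponent m + \<mu> -
  1/2, which changes with m, so the reading cannot be applied to the whole series at once. Each
  degree m is therefore compared separately with the Taylor coefficient of the Gegenbauer-type
  function. The constants (2\<mu>)_m / (2^m (\<mu> + 1/2)_m) of the statement are exactly those for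
  which the duplication formula for Pochhammer symbols makes the two agree.\<close>

text \<open>The classical Jacobi polynomial \<open>P\<^sub>N\<close> with parameters \<open>(\<alpha>, g)\<close>, evaluated at \<open>1 - 2t\<close>.\<close>

definition shifted_jacobi :: "real \<Rightarrow> real \<Rightarrow> nat \<Rightarrow> real \<Rightarrow> real" where
  "shifted_jacobi \<alpha> g N t = (\<Sum>j\<le>N. ((real N + \<alpha>) gchoose j) * ((real N + g) gchoose (N - j))
                       * (- t) ^ (N - j) * (1 - t) ^ j)"

text \<open>With u = 1 - 2t the radicand is 1 - 2uz + z^2, as in the classical generating functions
  of Legendre and Jacobi.\<close>

definition jacobi_radical :: "real \<Rightarrow> complex \<Rightarrow> complex" where
  "jacobi_radical t z = csqrt ((1 - z)\<^sup>2 + 4 * z * of_real t)"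

text \<open>The classical closed form at argument 1 - 2t. The quotients equal 1 at z = 0 and have
  positive real part on the unit disc, so principal powers need no branch correction.\<close>

definition jacobi_gf :: "real \<Rightarrow> real \<Rightarrow> real \<Rightarrow> complex \<Rightarrow> complex" where
  "jacobi_gf \<alpha> g t z = (2 / (1 - z + jacobi_radical t z)) powr of_real \<alpha>
                   * (2 / (1 + z + jacobi_radical t z)) powr of_real g / jacobi_radical t z"

lemma of_real_gbinomial: "of_real (a gchoose n) = ((of_real a :: complex) gchoose n)"
  by (simp add: gbinomial_prod_rev)

section \<open>Keeping the square root and the powers off the branch cut\<close>

lemma nonpos_Reals_Re_pos: "0 < Re z \<Longrightarrow> z \<notin> \<real>\<^sub>\<le>\<^sub>0"
  by (auto simp: complex_nonpos_Reals_iff)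

lemma Re_csqrt_pos: "z \<notin> \<real>\<^sub>\<le>\<^sub>0 \<Longrightarrow> 0 < Re (csqrt z)"
proof (rule ccontr)
  assume z: "z \<notin> \<real>\<^sub>\<le>\<^sub>0" and "\<not> 0 < Re (csqrt z)"
  then have "Re (csqrt z) = 0"
    using csqrt_principal[of z] by auto
  then have "csqrt z = \<i> * of_real (Im (csqrt z))"
    by (simp add: complex_eq_iff)
  then have "z = (\<i> * of_real (Im (csqrt z)))\<^sup>2"
    by (metis power2_csqrt)
  also have "\<dots> = of_real (- ((Im (csqrt z))\<^sup>2))"
    by (simp add: power_mult_distrib)
  finally show False
    using z by (metis nonpos_Reals_of_real_iff neg_le_0_iff_le zero_le_power2)
qed

lemma jacobi_radical_square: "(jacobi_radical t z)\<^sup>2 = (1 - z)\<^sup>2 + 4 * z * of_real t"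
  by (simp add: jacobi_radical_def)

text \<open>With c = 1 - 2t in [-1, 1] the radicand is z^2 - 2cz + 1. It is real only on the real
  axis and on the line Re z = c, where it equals (x - c)^2 + 1 - c^2 and 1 - |z|^2; both are
  positive inside the disc.\<close>

lemma jacobi_radical_radicand:
  fixes z :: complex
  assumes t: "0 \<le> t" "t \<le> 1" and z: "norm z < 1"
  shows "(1 - z)\<^sup>2 + 4 * z * of_real t \<notin> \<real>\<^sub>\<le>\<^sub>0"
proof
  assume "(1 - z)\<^sup>2 + 4 * z * of_real t \<in> \<real>\<^sub>\<le>\<^sub>0"
  then have im: "Im ((1 - z)\<^sup>2 + 4 * z * of_real t) = 0"
    and re: "Re ((1 - z)\<^sup>2 + 4 * z * of_real t) \<le> 0"
    by (auto simp: complex_nonpos_Reals_iff)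
  define x y c where "x = Re z" and "y = Im z" and "c = 1 - 2 * t"
  have n: "x\<^sup>2 + y\<^sup>2 < 1"
    using z unfolding x_def y_def cmod_def by (simp add: real_sqrt_lt_1_iff)
  have c: "c\<^sup>2 \<le> 1"
    using t unfolding c_def by (simp add: abs_square_le_1)
  have im': "y * (x - c) = 0"
    using im by (simp add: x_def y_def c_def power2_eq_square algebra_simps)
  have re': "1 - 2 * c * x + x\<^sup>2 - y\<^sup>2 \<le> 0"
    using re by (simp add: x_def y_def c_def power2_eq_square algebra_simps)
  show False
  proof (cases "y = 0")
    case True
    have "(x - c)\<^sup>2 + (1 - c\<^sup>2) \<le> 0"
      using re' True by (simp add: power2_eq_square algebra_simps)
    then have "(x - c)\<^sup>2 = 0" "c\<^sup>2 = 1"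
      using c zero_le_power2[of "x - c"] by linarith+
    then show False
      using n True by auto
  next
    case False
    then have "x = c"
      using im' by simp
    then show False
      using re' n by (simp add: power2_eq_square)
  qed
qed

lemma Re_jacobi_radical_pos:
  assumes "0 \<le> t" "t \<le> 1" "norm z < 1"
  shows "0 < Re (jacobi_radical t z)"
  unfolding jacobi_radical_def by (intro Re_csqrt_pos jacobi_radical_radicand assms)

lemma jacobi_radical_shift_Re_pos:
  assumes "0 \<le> t" "t \<le> 1" "norm z < 1"
  shows "1 - norm z < Re (1 - z + jacobi_radical t z)" "1 - norm z < Re (1 + z + jacobi_radical t z)"
  using Re_jacobi_radical_pos[OF assms] abs_Re_le_cmod[of z] by auto

lemma jacobi_radical_shift_nonzero:
  assumes "0 \<le> t" "t \<le> 1" "norm z < 1"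
  shows "jacobi_radical t z \<noteq> 0" "1 - z + jacobi_radical t z \<noteq> 0" "1 + z + jacobi_radical t z \<noteq> 0"
  using jacobi_radical_shift_Re_pos[OF assms] Re_jacobi_radical_pos[OF assms] assms(3) by fastforce+

section \<open>Jacobi polynomials as contour integrals, and Lagrange inversion\<close>

lemma fps_expansion_binomial_scaled:
  fixes c p :: complex
  shows "(\<lambda>y. (1 + c * y) powr p) has_fps_expansion Abs_fps (\<lambda>n. c ^ n * (p gchoose n))"
proof -
  have "(\<lambda>y. c * y) has_fps_expansion fps_const c * fps_X"
    by (intro fps_expansion_intros)
  then have "((\<lambda>y. (1 + y) powr p) \<circ> (\<lambda>y. c * y))
      has_fps_expansion fps_compose (fps_binomial p) (fps_const c * fps_X)"
    by (rule has_fps_expansion_compose[OF has_fps_expansion_binomial_complex]) simp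
  also have "fps_compose (fps_binomial p) (fps_const c * fps_X) = Abs_fps (\<lambda>n. c ^ n * (p gchoose n))"
    by (simp add: fps_compose_linear)
  finally show ?thesis
    by (simp add: o_def)
qed

text \<open>A Cauchy product of binomial series, those of (1 + (1 - t) y)^(N + \<alpha>) and (1 - t
  y)^(N + g). The exponents grow with N, which is the shape that Lagrange inversion needs.\<close>

lemma shifted_jacobi_eq_fps_nth:
  "complex_of_real (shifted_jacobi \<alpha> g N t) =
     fps_nth (Abs_fps (\<lambda>n. (1 - of_real t) ^ n * ((of_nat N + of_real \<alpha>) gchoose n))
              * Abs_fps (\<lambda>n. (- of_real t) ^ n * ((of_nat N + of_real g) gchoose n))) N"
  unfolding shifted_jacobi_def fps_mult_nth
  by (simp add: of_real_gbinomial atLeast0AtMost mult_ac)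

lemma Re_one_plus_pos:
  fixes y :: complex
  shows "norm y < 1 \<Longrightarrow> \<bar>c\<bar> \<le> 1 \<Longrightarrow> 0 < Re (1 + of_real c * y)"
proof -
  assume "norm y < 1" "\<bar>c\<bar> \<le> 1"
  then have "\<bar>Re (of_real c * y)\<bar> < 1"
    using abs_Re_le_cmod[of y] mult_le_one[of "\<bar>c\<bar>" "\<bar>Re y\<bar>"]
    by (simp add: abs_mult) (smt (verit) mult_left_le_one_le abs_ge_zero)
  then show ?thesis
    by auto
qed

text \<open>Splitting the exponents N + \<alpha> and N + g confines the dependence on N to a power
  of \<psi>(y) / y, so the sum over N with weights z^N becomes geometric under the integral.\<close>

lemma shifted_jacobi_contour_integral:
  fixes t \<alpha> g :: real
  assumes t: "0 \<le> t" "t \<le> 1"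
  defines "h \<equiv> \<lambda>y. (1 + of_real (1 - t) * y) powr of_real \<alpha> * (1 + of_real (- t) * y) powr (of_real g :: complex)"
    and "\<psi> \<equiv> \<lambda>y. (1 + of_real (1 - t) * y) * (1 + of_real (- t) * y)"
  shows "((\<lambda>y. h y * \<psi> y ^ N / y ^ Suc N) has_contour_integral (2 * of_real pi * \<i> * of_real (shifted_jacobi \<alpha> g N t)))
           (circlepath 0 (1/2))"
    and "h holomorphic_on ball 0 1"
proof -
  have pos: "0 < Re (1 + of_real (1 - t) * y)" "0 < Re (1 + of_real (- t) * y)" if "norm y < 1" for y :: complex
    using that t by (intro Re_one_plus_pos; simp)+
  have nz: "1 + of_real (1 - t) * y \<noteq> 0" "1 + of_real (- t) * y \<noteq> 0" if "norm y < 1" for y :: complex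
    using pos[OF that] by (auto simp: complex_eq_iff)
  define k where "k = (\<lambda>y. (1 + of_real (1 - t) * y) powr (of_nat N + of_real \<alpha>)
                       * (1 + of_real (- t) * y) powr (of_nat N + of_real g :: complex))"
  have k: "k y = h y * \<psi> y ^ N" if "norm y < 1" for y
    using nz[OF that] by (simp add: k_def h_def \<psi>_def powr_add powr_nat power_mult_distrib)
  show h: "h holomorphic_on ball 0 1"
    unfolding h_def using pos by (intro holomorphic_intros) (auto simp: nonpos_Reals_Re_pos)
  have kh: "k holomorphic_on ball 0 1"
    unfolding k_def using pos by (intro holomorphic_intros) (auto simp: nonpos_Reals_Re_pos)
  have "k has_fps_expansion Abs_fps (\<lambda>n. of_real (1 - t) ^ n * ((of_nat N + of_real \<alpha>) gchoose n))
              * Abs_fps (\<lambda>n. of_real (- t) ^ n * ((of_nat N + of_real g) gchoose n))"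
    unfolding k_def by (intro has_fps_expansion_mult fps_expansion_binomial_scaled)
  from fps_nth_fps_expansion[OF this, of N]
  have shifted_jacobi: "of_real (shifted_jacobi \<alpha> g N t) = (deriv ^^ N) k 0 / fact N"
    by (simp add: shifted_jacobi_eq_fps_nth)
  have "((\<lambda>y. k y / (y - 0) ^ Suc N) has_contour_integral ((2 * pi * \<i>) / (fact N) * (deriv ^^ N) k 0))
          (circlepath 0 (1/2))"
    by (rule Cauchy_has_contour_integral_higher_derivative_circlepath)
       (auto intro!: holomorphic_on_imp_continuous_on holomorphic_on_subset[OF kh])
  then have "((\<lambda>y. k y / y ^ Suc N) has_contour_integral (2 * of_real pi * \<i> * of_real (shifted_jacobi \<alpha> g N t)))
          (circlepath 0 (1/2))"
    by (simp add: shifted_jacobi)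
  then show "((\<lambda>y. h y * \<psi> y ^ N / y ^ Suc N) has_contour_integral (2 * of_real pi * \<i> * of_real (shifted_jacobi \<alpha> g N t)))
           (circlepath 0 (1/2))"
    by (rule has_contour_integral_eq) (auto simp: k)
qed

text \<open>
  Summing the contour integrals as a geometric series leaves a single pole inside the circle, at the
  small root \<open>y\<^sub>0\<close> of \<open>y = z \<psi>(y)\<close>; there \<open>1 - z \<psi>'(y\<^sub>0) = R\<close>.
\<close>

lemma jacobi_gf_sums_near_0:
  assumes t: "0 \<le> t" "t \<le> 1" and z: "norm z < 1 / 16"
  shows "(\<lambda>N. of_real (shifted_jacobi \<alpha> g N t) * z ^ N) sums jacobi_gf \<alpha> g t z"
proof -
  define h where "h \<equiv> \<lambda>y. (1 + of_real (1 - t) * y) powr of_real \<alpha> * (1 + of_real (- t) * y) powr (of_real g :: complex)"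
  define \<psi> where "\<psi> \<equiv> \<lambda>y :: complex. (1 + of_real (1 - t) * y) * (1 + of_real (- t) * y)"
  \<comment> \<open>\<open>y0\<close> is the root of y = z \<psi>(y) that tends to 0 with z. This
    rationalised form of the quadratic formula stays meaningful when the leading coefficient z t (1
    - t) vanishes.\<close>
  define R p q y0 where "R = jacobi_radical t z" and "p = 1 - z + R" and "q = 1 + z + R"
    and "y0 = 4 * z / (p * q)"
  define T :: complex where "T = of_real t"
  have z1: "norm z < 1"
    using z by simp
  have R2: "R\<^sup>2 = (1 - z)\<^sup>2 + 4 * z * T"
    by (simp add: R_def T_def jacobi_radical_square)
  have pq0: "p \<noteq> 0" "q \<noteq> 0"
    using jacobi_radical_shift_nonzero[OF t z1] by (simp_all add: p_def q_def R_def)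
  have e1: "1 + (1 - T) * y0 = 2 / p"
  proof -
    have "p * q + 4 * z * (1 - T) = 2 * q"
      using R2 unfolding p_def q_def by algebra
    then show ?thesis
      using pq0 by (simp add: y0_def field_simps)
  qed
  have e2: "1 - T * y0 = 2 / q"
  proof -
    have "p * q - 4 * z * T = 2 * p"
      using R2 unfolding p_def q_def by algebra
    then show ?thesis
      using pq0 unfolding y0_def by (simp add: divide_eq_eq eq_divide_eq diff_divide_eq_iff mult_ac)
  qed
  have psi0: "\<psi> y0 = 4 / (p * q)"
  proof -
    have "\<psi> y0 = (1 + (1 - T) * y0) * (1 - T * y0)"
      by (simp add: \<psi>_def T_def)
    then show ?thesis
      unfolding e1 e2 by simp
  qed
  have root: "y0 = z * \<psi> y0"
    unfolding psi0 by (simp add: y0_def)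
  have h0: "h y0 = (2 / p) powr of_real \<alpha> * (2 / q) powr of_real g"
    using e1 e2 by (simp add: h_def T_def)
  have der: "z * T * (1 - T) * (y0 + y0) + 1 - z * (1 - 2 * T) = R"
  proof -
    have "8 * z * z * T * (1 - T) + (1 - z * (1 - 2 * T)) * (p * q) = R * (p * q)"
      using R2 unfolding p_def q_def by algebra
    then show ?thesis
      using pq0 by (simp add: y0_def field_simps)
  qed
  \<comment> \<open>The cofactor of y - y0 is used instead of the second root, which escapes to
    infinity as the leading coefficient tends to 0. At y = y0 the cofactor is 1 - z \<psi>'(y0),
    hence R by \<open>der\<close>.\<close>
  have factor: "y - z * \<psi> y = (y - y0) * (z * T * (1 - T) * (y + y0) + 1 - z * (1 - 2 * T))" for y
  proof -
    have "y - z * \<psi> y = (y - z * \<psi> y) - (y0 - z * \<psi> y0)"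
      using root by simp
    also have "\<dots> = (y - y0) * (z * T * (1 - T) * (y + y0) + 1 - z * (1 - 2 * T))"
      by (simp add: \<psi>_def T_def algebra_simps)
    finally show ?thesis .
  qed
  \<comment> \<open>The real parts of p and q exceed 1 - |z| > 15/16, so |y0| < (1/4) / (15/16)^2 =
    64/225.\<close>
  have y0: "norm y0 < 1 / 2"
  proof -
    have "15 / 16 < norm p" "15 / 16 < norm q"
      using jacobi_radical_shift_Re_pos[OF t z1] complex_Re_le_cmod[of p] complex_Re_le_cmod[of q] z
      by (auto simp: p_def q_def R_def)
    then have "15 / 16 * (15 / 16) < norm p * norm q"
      by (intro mult_strict_mono) auto
    then show ?thesis
      using z pq0 by (simp add: y0_def norm_mult norm_divide divide_simps)
  qed
  have T: "norm T \<le> 1" "norm (1 - T) \<le> 1" "norm (1 - 2 * T) \<le> 1"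
  proof -
    have "1 - T = of_real (1 - t)" "1 - 2 * T = of_real (1 - 2 * t)"
      by (simp_all add: T_def)
    then show "norm T \<le> 1" "norm (1 - T) \<le> 1" "norm (1 - 2 * T) \<le> 1"
      using t by (auto simp only: norm_of_real T_def)
  qed
  have nz: "z * T * (1 - T) * (y + y0) + 1 - z * (1 - 2 * T) \<noteq> 0" if "norm y < 1" for y
  proof
    assume "z * T * (1 - T) * (y + y0) + 1 - z * (1 - 2 * T) = 0"
    then have "1 = z * (1 - 2 * T) - z * T * (1 - T) * (y + y0)"
      by algebra
    then have "1 \<le> norm (z * (1 - 2 * T)) + norm (z * T * (1 - T) * (y + y0))"
      by (metis norm_one norm_triangle_ineq4)
    also have "norm (z * (1 - 2 * T)) \<le> norm z * 1"
      unfolding norm_mult by (intro mult_left_mono T) auto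
    also have "norm (z * T * (1 - T) * (y + y0)) \<le> norm z * 1 * 1 * 2"
      unfolding norm_mult using norm_triangle_ineq[of y y0] that y0
      by (intro mult_mono T) auto
    finally show False
      using z by simp
  qed
  define f where "f = (\<lambda>N y. z ^ N * (h y * \<psi> y ^ N / y ^ Suc N))"
  have ci: "((\<lambda>y. h y * \<psi> y ^ N / y ^ Suc N) has_contour_integral
      (2 * of_real pi * \<i> * of_real (shifted_jacobi \<alpha> g N t))) (circlepath 0 (1/2))" for N
    unfolding h_def \<psi>_def by (rule shifted_jacobi_contour_integral[OF t])
  have h_hol: "h holomorphic_on ball 0 1"
    unfolding h_def by (rule shifted_jacobi_contour_integral[OF t])
  have f_ci: "(f N has_contour_integral (z ^ N * (2 * of_real pi * \<i> * of_real (shifted_jacobi \<alpha> g N t))))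
                (circlepath 0 (1/2))" for N
    unfolding f_def by (intro has_contour_integral_lmul ci)
  have "continuous_on (sphere 0 (1/2)) h"
    by (intro holomorphic_on_imp_continuous_on holomorphic_on_subset[OF h_hol]) auto
  then have "bounded (h ` sphere 0 (1/2))"
    by (intro compact_imp_bounded compact_continuous_image) auto
  then obtain C where C: "norm (h y) \<le> C" if "norm y = 1 / 2" for y
    unfolding bounded_iff by fastforce
  \<comment> \<open>The ratio is at most (1/16) (9/4) 2 = 9/32 on the circle. The radius 1/16 is a
    mere convenience: afterwards only the germ at 0 is used.\<close>
  have quot: "norm (z * \<psi> y / y) \<le> 1 / 2" if y: "norm y = 1 / 2" for y
  proof -
    have bound: "norm (1 + of_real c * y) \<le> 3 / 2" if "\<bar>c\<bar> \<le> 1" for c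
      using norm_triangle_ineq[of 1 "of_real c * y"] y that by (simp add: norm_mult)
    have "norm (1 + of_real (1 - t) * y) \<le> 3 / 2" "norm (1 + of_real (- t) * y) \<le> 3 / 2"
      using t by (intro bound; simp)+
    then have "norm (\<psi> y) \<le> 3 / 2 * (3 / 2)"
      unfolding \<psi>_def norm_mult by (intro mult_mono) auto
    then have "norm z * norm (\<psi> y) \<le> 1 / 16 * (3 / 2 * (3 / 2))"
      using z by (intro mult_mono) auto
    then show ?thesis
      by (simp add: norm_mult norm_divide y)
  qed
  have f_eq: "f N y = h y / y * (z * \<psi> y / y) ^ N" for N y
    by (simp add: f_def power_mult_distrib power_divide)
  have unif: "uniform_limit (sphere 0 (1/2)) (\<lambda>n y. \<Sum>N<n. f N y) (\<lambda>y. \<Sum>N. f N y) sequentially"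
  proof (rule Weierstrass_m_test)
    fix N and y :: complex
    assume "y \<in> sphere 0 (1/2)"
    then have y: "norm y = 1 / 2"
      by simp
    show "norm (f N y) \<le> 2 * C * (1 / 2) ^ N"
      unfolding f_eq norm_mult norm_power using quot[OF y] C[OF y] order_trans[OF norm_ge_zero C[OF y]]
      by (intro mult_mono power_mono) (auto simp: norm_divide y)
  next
    show "summable (\<lambda>N. 2 * C * (1 / 2) ^ N)"
      by (intro summable_mult summable_geometric) auto
  qed
  have lim: "(\<Sum>N. f N y) = h y / (z * T * (1 - T) * (y + y0) + 1 - z * (1 - 2 * T)) / (y - y0)"
    if y: "norm y = 1 / 2" for y
  proof -
    have "(\<Sum>N. f N y) = h y / y * (1 / (1 - z * \<psi> y / y))"
      unfolding f_eq using quot[OF y]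
      by (subst suminf_mult) (auto intro!: summable_geometric simp: suminf_geometric)
    also have "\<dots> = h y / (y - z * \<psi> y)"
      using y by (auto simp: field_simps)
    finally show ?thesis
      unfolding factor by simp
  qed
  have "((\<lambda>y. h y / (z * T * (1 - T) * (y + y0) + 1 - z * (1 - 2 * T)) / (y - y0)) has_contour_integral
          (2 * of_real pi * \<i> * (h y0 / R))) (circlepath 0 (1/2))"
    unfolding der[symmetric] using y0 nz
    by (intro Cauchy_integral_circlepath_simple holomorphic_intros holomorphic_on_subset[OF h_hol]) auto
  then have "((\<lambda>y. \<Sum>N. f N y) has_contour_integral (2 * of_real pi * \<i> * (h y0 / R))) (circlepath 0 (1/2))"
    by (rule has_contour_integral_eq) (auto simp: lim)
  then have ci_lim: "contour_integral (circlepath 0 (1/2)) (\<lambda>y. \<Sum>N. f N y) = 2 * of_real pi * \<i> * (h y0 / R)"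
    by (rule contour_integral_unique)
  have sum_ci: "((\<lambda>y. \<Sum>N<n. f N y) has_contour_integral
                (\<Sum>N<n. z ^ N * (2 * of_real pi * \<i> * of_real (shifted_jacobi \<alpha> g N t)))) (circlepath 0 (1/2))" for n
    by (intro has_contour_integral_sum f_ci) auto
  have "(\<lambda>n. contour_integral (circlepath 0 (1/2)) (\<lambda>y. \<Sum>N<n. f N y))
          \<longlonglongrightarrow> contour_integral (circlepath 0 (1/2)) (\<lambda>y. \<Sum>N. f N y)"
    using sum_ci
    by (intro contour_integral_uniform_limit_circlepath[OF _ unif])
       (auto intro!: always_eventually has_contour_integral_integrable)
  then have "(\<lambda>N. z ^ N * (2 * of_real pi * \<i> * of_real (shifted_jacobi \<alpha> g N t))) sums (2 * of_real pi * \<i> * (h y0 / R))"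
    unfolding ci_lim contour_integral_unique[OF sum_ci] sums_def .
  then have "(\<lambda>N. z ^ N * (2 * of_real pi * \<i> * of_real (shifted_jacobi \<alpha> g N t)) / (2 * of_real pi * \<i>))
               sums (2 * of_real pi * \<i> * (h y0 / R) / (2 * of_real pi * \<i>))"
    by (rule sums_divide)
  then show ?thesis
    by (simp add: h0 jacobi_gf_def p_def q_def R_def mult_ac)
qed

lemma jacobi_gf_has_fps_expansion:
  assumes t: "0 \<le> t" "t \<le> 1"
  shows "jacobi_gf \<alpha> g t has_fps_expansion Abs_fps (\<lambda>N. of_real (shifted_jacobi \<alpha> g N t))"
proof (rule has_fps_expansionI)
  have "eventually (\<lambda>z::complex. z \<in> ball 0 (1/16)) (nhds 0)"
    by (intro eventually_nhds_in_open) auto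
  then show "\<forall>\<^sub>F z in nhds 0. (\<lambda>n. fps_nth (Abs_fps (\<lambda>N. complex_of_real (shifted_jacobi \<alpha> g N t))) n * z ^ n) sums jacobi_gf \<alpha> g t z"
    by eventually_elim (use jacobi_gf_sums_near_0[OF t] in auto)
qed

section \<open>Holomorphic extension to the whole unit disc\<close>

lemma jacobi_radical_holomorphic:
  assumes "0 \<le> t" "t \<le> 1"
  shows "jacobi_radical t holomorphic_on ball 0 1"
  unfolding jacobi_radical_def using jacobi_radical_radicand[OF assms] by (intro holomorphic_intros) auto

text \<open>Up to the positive factor |1 - z|^2 this is the real part of R / (1 - z). It is 1 at z =
  0 and continuous along the segment from 0 to z, so it would have to vanish somewhere before
  failing to be positive.\<close>

lemma Re_jacobi_radical_cnj_pos:
  assumes t: "0 \<le> t" "t \<le> 1" and z: "norm z < 1"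
  shows "0 < Re (jacobi_radical t z * cnj (1 - z))"
proof (rule ccontr)
  define \<phi> where "\<phi> = (\<lambda>\<tau>. Re (jacobi_radical t (of_real \<tau> * z) * cnj (1 - of_real \<tau> * z)))"
  have small: "norm (of_real \<tau> * z) < 1" if "0 \<le> \<tau>" "\<tau> \<le> 1" for \<tau>
  proof -
    have "norm (of_real \<tau> * z) \<le> 1 * norm z"
      unfolding norm_mult using that by (intro mult_right_mono) auto
    then show ?thesis
      using z by simp
  qed
  \<comment> \<open>If the real part vanished at \<open>w\<close>, the radicand at \<open>w\<close> would have a zero for the smaller
    parameter \<open>t / (1 + p)\<close>.\<close>
  assume "\<not> 0 < Re (jacobi_radical t z * cnj (1 - z))"
  then have "\<phi> 1 \<le> 0"
    by (simp add: \<phi>_def)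
  moreover have "\<phi> 0 \<ge> 0"
    by (simp add: \<phi>_def jacobi_radical_def)
  moreover have "continuous_on {0..1} \<phi>"
    unfolding \<phi>_def using small
    by (intro continuous_intros continuous_on_compose2[OF holomorphic_on_imp_continuous_on[OF jacobi_radical_holomorphic[OF t]]]) auto
  ultimately obtain \<tau> where \<tau>: "0 \<le> \<tau>" "\<tau> \<le> 1" "\<phi> \<tau> = 0"
    using IVT2'[of \<phi> 1 0 0] by auto
  define w where "w = of_real \<tau> * z"
  have w: "norm w < 1"
    using small \<tau> by (simp add: w_def)
  define X where "X = jacobi_radical t w * cnj (1 - w)"
  \<comment> \<open>At w the quotient R / (1 - w) is purely imaginary, and \<open>p\<close> is minus
    its square.\<close>
  define p where "p = (Im X)\<^sup>2 / (norm (1 - w)) ^ 4"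
  have w1: "1 - w \<noteq> 0"
    using w by auto
  have "Re X = 0"
    using \<tau>(3) by (simp add: \<phi>_def X_def w_def)
  then have "X\<^sup>2 = - of_real ((Im X)\<^sup>2)"
    by (simp add: complex_eq_iff power2_eq_square)
  then have "(jacobi_radical t w)\<^sup>2 * (cnj (1 - w) * (1 - w))\<^sup>2 = - of_real ((Im X)\<^sup>2) * (1 - w)\<^sup>2"
    by (simp add: X_def power_mult_distrib mult_ac)
  also have "cnj (1 - w) * (1 - w) = of_real ((norm (1 - w))\<^sup>2)"
    by (metis complex_norm_square mult.commute)
  finally have "(jacobi_radical t w)\<^sup>2 = - of_real p * (1 - w)\<^sup>2"
    using w1 by (simp add: p_def field_simps flip: power_mult)
  then have "(1 - w)\<^sup>2 * of_real (1 + p) + 4 * w * of_real t = 0"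
    unfolding jacobi_radical_square of_real_add of_real_1 by algebra
  moreover have p: "p \<ge> 0"
    by (simp add: p_def)
  ultimately have "(1 - w)\<^sup>2 + 4 * w * of_real (t / (1 + p)) = 0"
    by (simp add: divide_simps del: of_real_add)
  moreover have "0 \<le> t / (1 + p)" "t / (1 + p) \<le> 1"
    using p t by (auto simp: divide_simps)
  ultimately show False
    using jacobi_radical_radicand[of "t / (1 + p)" w] w by auto
qed

text \<open>The squares of the two moduli differ by 4 Re (a cnj b).\<close>

lemma cmod_diff_less_add:
  assumes "0 < Re (a * cnj b)"
  shows "norm (a - b) < norm (a + b)"
proof -
  have "(norm (a - b))\<^sup>2 < (norm (a + b))\<^sup>2"
    unfolding cmod_power2 using assms by (simp add: power2_eq_square algebra_simps)
  then show ?thesis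
    by (rule power2_less_imp_less) auto
qed

definition gegen_arg :: "real \<Rightarrow> complex \<Rightarrow> complex" where
  "gegen_arg t z = 4 * z / (1 - z + jacobi_radical t z)\<^sup>2"

text \<open>Since R^2 - (1 - z)^2 = 4zt, the product of \<open>gegen_arg t z\<close> and t is (R -
  (1 - z)) / (R + (1 - z)), which has modulus below 1 because R / (1 - z) lies in the right
  half-plane.\<close>

lemma gegen_arg_norm:
  assumes t: "0 \<le> t" "t \<le> 1" and z: "norm z < 1"
  shows "norm (gegen_arg t z) * t < 1"
proof -
  let ?R = "jacobi_radical t z"
  have "gegen_arg t z * of_real t = 4 * z * of_real t / (1 - z + ?R)\<^sup>2"
    by (simp add: gegen_arg_def)
  also have "4 * z * of_real t = (?R - (1 - z)) * (?R + (1 - z))"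
    using jacobi_radical_square[of t z] by algebra
  also have "\<dots> / (1 - z + ?R)\<^sup>2 = (?R - (1 - z)) / (?R + (1 - z))"
    by (simp add: power2_eq_square add.commute)
  finally have "norm (gegen_arg t z) * t = norm (?R - (1 - z)) / norm (?R + (1 - z))"
    using t by (metis abs_of_nonneg norm_divide norm_mult norm_of_real)
  also have "\<dots> < 1"
    using cmod_diff_less_add[OF Re_jacobi_radical_cnj_pos[OF assms]]
    by (subst divide_less_eq_1_pos) (auto intro: le_less_trans[OF norm_ge_zero])
  finally show ?thesis .
qed

lemma gegen_arg_holomorphic:
  assumes "0 \<le> t" "t \<le> 1"
  shows "gegen_arg t holomorphic_on ball 0 1"
  unfolding gegen_arg_def using jacobi_radical_shift_nonzero[OF assms]
  by (intro holomorphic_intros jacobi_radical_holomorphic assms) auto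

lemma jacobi_gf_holomorphic:
  assumes "0 \<le> t" "t \<le> 1"
  shows "jacobi_gf \<alpha> g t holomorphic_on ball 0 1"
proof -
  have pos: "2 / w \<notin> \<real>\<^sub>\<le>\<^sub>0" if "0 < Re w" for w
    using that by (intro nonpos_Reals_Re_pos) (simp add: Re_divide divide_simps sum_power2_gt_zero_iff)
  have nonpos: "2 / (1 - z + jacobi_radical t z) \<notin> \<real>\<^sub>\<le>\<^sub>0" "2 / (1 + z + jacobi_radical t z) \<notin> \<real>\<^sub>\<le>\<^sub>0" if "norm z < 1" for z
    using jacobi_radical_shift_Re_pos[OF assms that] that by (intro pos; linarith)+
  show ?thesis
    unfolding jacobi_gf_def using jacobi_radical_shift_nonzero[OF assms] nonpos
    by (intro holomorphic_intros jacobi_radical_holomorphic assms) auto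
qed

text \<open>Each increase of the parameter by 2 contributes 4 / (1 - z + R)^2. The factor z^m is
  kept on the right so that the identity includes z = 0 and becomes multiplication by
  \<open>fps_X ^ m\<close>, the source of the index n - m.\<close>

lemma jacobi_gf_mult_gegen_arg_power:
  assumes "0 \<le> t" "t \<le> 1" "norm z < 1"
  shows "jacobi_gf \<alpha> g t z * gegen_arg t z ^ m = z ^ m * jacobi_gf (\<alpha> + 2 * real m) g t z"
proof -
  let ?p = "1 - z + jacobi_radical t z"
  have p: "?p \<noteq> 0"
    using jacobi_radical_shift_nonzero[OF assms] by simp
  have "(2 / ?p) powr of_real (\<alpha> + 2 * real m) = (2 / ?p) powr of_real \<alpha> * (2 / ?p) ^ (2 * m)"
    using p powr_nat'[of "2 / ?p" "2 * m"] by (simp add: powr_add)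
  also have "(2 / ?p) ^ (2 * m) = (4 / ?p\<^sup>2) ^ m"
    by (simp add: power_mult power_divide)
  finally have *: "(2 / ?p) powr of_real (\<alpha> + 2 * real m) = (2 / ?p) powr of_real \<alpha> * (4 / ?p\<^sup>2) ^ m" .
  have "gegen_arg t z ^ m = z ^ m * (4 / ?p\<^sup>2) ^ m"
    by (simp add: gegen_arg_def power_divide power_mult_distrib)
  then show ?thesis
    unfolding jacobi_gf_def * by simp
qed

subsection \<open>The Gegenbauer-type factor\<close>

text \<open>
  The function \<open>((1 - cs)\<^sup>2 + Ds\<^sup>2) powr (-\<mu>)\<close>, split so that both principal powers are
  holomorphic on the whole range of \<open>s\<close>.
\<close>

definition gegen :: "real \<Rightarrow> real \<Rightarrow> real \<Rightarrow> complex \<Rightarrow> complex" where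
  "gegen c D \<mu> s = (1 - of_real c * s) powr of_real (- 2 * \<mu>)
                     * (1 + of_real D * s\<^sup>2 / (1 - of_real c * s)\<^sup>2) powr of_real (- \<mu>)"

text \<open>For \<rho> = sqrt (c^2 + D) > 0 this is \<rho>^m times the Gegenbauer polynomial of
  degree m and parameter \<mu> at c / \<rho>. The sum arises by expanding the second power in
  \<open>gegen\<close> first.\<close>

definition gegen_coeff :: "real \<Rightarrow> real \<Rightarrow> real \<Rightarrow> nat \<Rightarrow> real" where
  "gegen_coeff c D \<mu> m = (\<Sum>j\<le>m div 2. ((- \<mu>) gchoose j) * ((- 2 * \<mu> - 2 * real j) gchoose (m - 2 * j))
                              * (- c) ^ (m - 2 * j) * D ^ j)"

text \<open>If the second base were a real q \<le> 0, then sqrt D s = \<plusminus> i P (1 - c s)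
  with P^2 = 1 - q \<ge> 1. Solving for s gives |s|^2 = P^2 / (D + P^2 c^2) \<ge> 1 / (c^2 + D),
  against the hypothesis.\<close>

lemma gegen_base:
  fixes s :: complex
  assumes D: "0 \<le> D" and s: "(c\<^sup>2 + D) * (norm s)\<^sup>2 < 1"
  shows "1 - of_real c * s \<notin> \<real>\<^sub>\<le>\<^sub>0"
    and "1 + of_real D * s\<^sup>2 / (1 - of_real c * s)\<^sup>2 \<notin> \<real>\<^sub>\<le>\<^sub>0"
proof -
  have "(c * norm s)\<^sup>2 < 1"
  proof -
    have "(c * norm s)\<^sup>2 + D * (norm s)\<^sup>2 < 1"
      using s by (simp add: power_mult_distrib algebra_simps)
    moreover have "0 \<le> D * (norm s)\<^sup>2"
      using D by simp
    ultimately show ?thesis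
      by linarith
  qed
  then have "norm (of_real c * s) < 1"
    by (simp add: norm_mult abs_square_less_1 abs_mult)
  then have pos: "0 < Re (1 - of_real c * s)"
    using complex_Re_le_cmod[of "of_real c * s"] by simp
  then show 1: "1 - of_real c * s \<notin> \<real>\<^sub>\<le>\<^sub>0"
    by (rule nonpos_Reals_Re_pos)
  then have nz: "1 - of_real c * s \<noteq> 0"
    by auto
  show "1 + of_real D * s\<^sup>2 / (1 - of_real c * s)\<^sup>2 \<notin> \<real>\<^sub>\<le>\<^sub>0"
  proof
    assume "1 + of_real D * s\<^sup>2 / (1 - of_real c * s)\<^sup>2 \<in> \<real>\<^sub>\<le>\<^sub>0"
    then obtain q where q: "q \<le> 0" "1 + of_real D * s\<^sup>2 / (1 - of_real c * s)\<^sup>2 = of_real q"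
      by (auto elim: nonpos_Reals_cases)
    define P where "P = sqrt (1 - q)"
    have P: "P\<^sup>2 = 1 - q" "P \<ge> 1"
      using q(1) by (auto simp: P_def)
    have "of_real D * s\<^sup>2 = of_real (q - 1) * (1 - of_real c * s)\<^sup>2"
      using q(2) nz by (simp add: field_simps)
    moreover have "of_real D = (of_real (sqrt D) :: complex)\<^sup>2"
      using D by (simp flip: of_real_power)
    moreover have "of_real (q - 1) = (\<i> * of_real P)\<^sup>2"
      using P(1) by (simp add: power_mult_distrib flip: of_real_power)
    ultimately have "(of_real (sqrt D) * s)\<^sup>2 = (\<i> * of_real P * (1 - of_real c * s))\<^sup>2"
      by (simp only: power_mult_distrib)
    then have "of_real (sqrt D) * s = \<i> * of_real P * (1 - of_real c * s)
             \<or> of_real (sqrt D) * s = - (\<i> * of_real P * (1 - of_real c * s))"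
      by (simp only: power2_eq_iff)
    then have "s * (of_real (sqrt D) + \<i> * of_real (P * c)) = \<i> * of_real P
             \<or> s * (of_real (sqrt D) - \<i> * of_real (P * c)) = - \<i> * of_real P"
      by (auto simp: algebra_simps)
    moreover have n: "norm (of_real (sqrt D) + \<i> * of_real (P * c)) = sqrt (D + P\<^sup>2 * c\<^sup>2)"
       "norm (of_real (sqrt D) - \<i> * of_real (P * c)) = sqrt (D + P\<^sup>2 * c\<^sup>2)"
      using D by (simp_all add: cmod_def power_mult_distrib)
    moreover have "norm (\<i> * of_real P) = P" "norm (- \<i> * of_real P) = P"
      using P by (simp_all add: norm_mult)
    ultimately have "norm s * sqrt (D + P\<^sup>2 * c\<^sup>2) = P"
      by (metis norm_mult)
    then have "(norm s)\<^sup>2 * (D + P\<^sup>2 * c\<^sup>2) = P\<^sup>2"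
      using D by (metis power_mult_distrib real_sqrt_pow2 add_nonneg_nonneg mult_nonneg_nonneg zero_le_power2)
    moreover have "D \<le> P\<^sup>2 * D"
      using P D q(1) by (simp add: mult_le_cancel_right1)
    then have "(norm s)\<^sup>2 * (D + P\<^sup>2 * c\<^sup>2) \<le> (norm s)\<^sup>2 * (P\<^sup>2 * D + P\<^sup>2 * c\<^sup>2)"
      by (intro mult_left_mono) auto
    moreover have "(norm s)\<^sup>2 * (P\<^sup>2 * D + P\<^sup>2 * c\<^sup>2) = P\<^sup>2 * ((c\<^sup>2 + D) * (norm s)\<^sup>2)"
      by (simp add: algebra_simps)
    moreover have "P\<^sup>2 * ((c\<^sup>2 + D) * (norm s)\<^sup>2) < P\<^sup>2 * 1"
      using P s q(1) by (intro mult_strict_left_mono) auto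
    ultimately show False
      by simp
  qed
qed

text \<open>Keeping the prefactor P inside each summand allows P * a^i to be simplified as a whole,
  which is where both applications gain their closed form.\<close>

lemma fps_mult_compose_nth:
  fixes P F a :: "'a::{comm_ring_1} fps"
  assumes "fps_nth a 0 = 0"
  shows "fps_nth (P * (F oo a)) n = (\<Sum>i\<le>n. fps_nth F i * fps_nth (P * a ^ i) n)"
proof -
  have "fps_nth (F oo a) k = (\<Sum>i\<le>n. fps_nth F i * fps_nth (a ^ i) k)" if "k \<le> n" for k
    unfolding fps_compose_nth using that startsby_zero_power_prefix[OF assms]
    by (intro sum.mono_neutral_left) auto
  then have "fps_nth (P * (F oo a)) n = (\<Sum>k=0..n. fps_nth P k * (\<Sum>i\<le>n. fps_nth F i * fps_nth (a ^ i) (n - k)))"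
    by (simp add: fps_mult_nth)
  also have "\<dots> = (\<Sum>i\<le>n. \<Sum>k=0..n. fps_nth F i * (fps_nth P k * fps_nth (a ^ i) (n - k)))"
    unfolding sum_distrib_left by (subst sum.swap) (intro sum.cong refl mult.left_commute)
  also have "\<dots> = (\<Sum>i\<le>n. fps_nth F i * fps_nth (P * a ^ i) n)"
    by (simp add: fps_mult_nth sum_distrib_left)
  finally show ?thesis .
qed

text \<open>Formally \<open>B p\<close> is (1 - c s)^p, and such series multiply by adding
  exponents. Hence the j-th term of the outer binomial series is a multiple of D^j s^(2j) (1 - c
  s)^(-2\<mu> - 2j).\<close>

lemma gegen_has_fps_expansion:
  "gegen c D \<mu> has_fps_expansion Abs_fps (\<lambda>n. of_real (gegen_coeff c D \<mu> n))"
proof -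
  define C D' M :: complex where "C = of_real (- c)" and "D' = of_real D" and "M = of_real (- \<mu>)"
  define B where "B = (\<lambda>p :: complex. fps_binomial p oo (fps_const C * fps_X))"
  define G where "G = fps_const D' * fps_X ^ 2 * B (- 2)"
  have B_nth: "fps_nth (B p) n = C ^ n * (p gchoose n)" for p n
    by (simp add: B_def fps_compose_linear)
  have B_exp: "(\<lambda>s. (1 + C * s) powr p) has_fps_expansion B p" for p
    using fps_expansion_binomial_scaled[of C p] by (simp add: B_def fps_compose_linear)
  have B_mult: "B p * B q = B (p + q)" for p q
    by (simp add: B_def fps_binomial_add_mult fps_compose_mult_distrib)
  have B_power: "B p ^ n = B (of_nat n * p)" for p n
    by (induction n) (simp_all add: B_mult algebra_simps, simp add: B_def)
  have G0: "fps_nth G 0 = 0"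
    by (simp add: G_def)
  have "(\<lambda>s. D' * s ^ 2 * (1 + C * s) powr (- 2)) has_fps_expansion G"
    unfolding G_def by (intro fps_expansion_intros B_exp)
  then have "((\<lambda>y. (1 + y) powr M) \<circ> (\<lambda>s. D' * s ^ 2 * (1 + C * s) powr (- 2)))
               has_fps_expansion (fps_binomial M oo G)"
    by (intro has_fps_expansion_compose has_fps_expansion_binomial_complex G0)
  then have "(\<lambda>s. (1 + C * s) powr (2 * M) * ((\<lambda>y. (1 + y) powr M) \<circ> (\<lambda>s. D' * s ^ 2 * (1 + C * s) powr (- 2))) s)
               has_fps_expansion B (2 * M) * (fps_binomial M oo G)"
    by (intro has_fps_expansion_mult B_exp)
  also have "(\<lambda>s. (1 + C * s) powr (2 * M) * ((\<lambda>y. (1 + y) powr M) \<circ> (\<lambda>s. D' * s ^ 2 * (1 + C * s) powr (- 2))) s)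
               = gegen c D \<mu>"
    by (simp add: fun_eq_iff gegen_def C_def D'_def M_def powr_minus divide_inverse)
  also have "B (2 * M) * (fps_binomial M oo G) = Abs_fps (\<lambda>n. of_real (gegen_coeff c D \<mu> n))"
  proof (rule fps_ext)
    fix n
    have "B (2 * M) * G ^ j = fps_const (D' ^ j) * (fps_X ^ (2 * j) * B (2 * M - 2 * of_nat j))" for j
    proof -
      have "B (2 * M) * G ^ j = fps_const (D' ^ j) * (fps_X ^ (2 * j) * (B (2 * M) * B (- 2) ^ j))"
        by (simp add: G_def power_mult_distrib mult_ac flip: power_mult fps_const_power)
      also have "B (2 * M) * B (- 2) ^ j = B (2 * M - 2 * of_nat j)"
        by (simp add: B_power B_mult algebra_simps)
      finally show ?thesis .
    qed
    then have "fps_nth (B (2 * M) * (fps_binomial M oo G)) n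
       = (\<Sum>j\<le>n. (M gchoose j) * (D' ^ j * (if n < 2 * j then 0
             else C ^ (n - 2 * j) * ((2 * M - 2 * of_nat j) gchoose (n - 2 * j)))))"
      by (simp add: fps_mult_compose_nth[OF G0] fps_X_power_mult_nth B_nth cong: if_cong)
    also have "\<dots> = (\<Sum>j\<le>n div 2. (M gchoose j) * (D' ^ j *
             (C ^ (n - 2 * j) * ((2 * M - 2 * of_nat j) gchoose (n - 2 * j)))))"
      by (intro sum.mono_neutral_cong_right) auto
    also have "\<dots> = of_real (gegen_coeff c D \<mu> n)"
      by (simp add: gegen_coeff_def of_real_gbinomial C_def D'_def M_def mult_ac)
    finally show "fps_nth (B (2 * M) * (fps_binomial M oo G)) n
        = fps_nth (Abs_fps (\<lambda>n. of_real (gegen_coeff c D \<mu> n))) n"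
      by simp
  qed
  finally show ?thesis .
qed

text \<open>The condition c^2 + D \<le> t^2 is what |b| \<le> 1 and Cauchy-Schwarz give on the cone;
  it turns |s| t < 1 into the hypothesis of \<open>gegen_base\<close>.\<close>

lemma gegen_base_gegen_arg:
  assumes t: "0 \<le> t" "t \<le> 1" and z: "norm z < 1" and cD: "c\<^sup>2 + D \<le> t\<^sup>2"
  shows "(c\<^sup>2 + D) * (norm (gegen_arg t z))\<^sup>2 < 1"
proof -
  have "(c\<^sup>2 + D) * (norm (gegen_arg t z))\<^sup>2 \<le> (norm (gegen_arg t z) * t)\<^sup>2"
    unfolding power_mult_distrib mult.commute[of _ "t\<^sup>2"] using cD by (intro mult_right_mono) auto
  also have "\<dots> < 1"
    using gegen_arg_norm[OF t z] t by (simp add: abs_square_less_1 abs_mult)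
  finally show ?thesis .
qed

lemma gegen_gegen_arg_holomorphic:
  assumes t: "0 \<le> t" "t \<le> 1" and D: "0 \<le> D" and cD: "c\<^sup>2 + D \<le> t\<^sup>2"
  shows "(\<lambda>z. gegen c D \<mu> (gegen_arg t z)) holomorphic_on ball 0 1"
proof -
  note base = gegen_base[OF D gegen_base_gegen_arg[OF t _ cD]]
  have "1 - of_real c * gegen_arg t z \<noteq> 0" if "norm z < 1" for z
    using base(1)[OF that] by auto
  then show ?thesis
    unfolding gegen_def using base
    by (intro holomorphic_intros gegen_arg_holomorphic t) auto
qed

subsection \<open>The generating function on the unit disc\<close>

lemma generating_function_complex:
  assumes t: "0 \<le> t" "t \<le> 1" and D: "0 \<le> D" and cD: "c\<^sup>2 + D \<le> t\<^sup>2" and z: "norm z < 1"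
  shows "(\<lambda>n. of_real (\<Sum>m\<le>n. gegen_coeff c D \<mu> m * shifted_jacobi (\<alpha> + 2 * real m) g (n - m) t) * z ^ n)
           sums (jacobi_gf \<alpha> g t z * gegen c D \<mu> (gegen_arg t z))"
proof -
  define J where "J = (\<lambda>\<alpha>. Abs_fps (\<lambda>N. complex_of_real (shifted_jacobi \<alpha> g N t)))"
  define A where "A = Abs_fps (\<lambda>n. complex_of_real (gegen_coeff c D \<mu> n))"
  define S where "S = fps_expansion (gegen_arg t) 0"
  have in_ball: "eventually (\<lambda>z::complex. z \<in> ball 0 1) (nhds 0)"
    by (intro eventually_nhds_in_open) auto
  have "gegen_arg t analytic_on {0}"
    using gegen_arg_holomorphic[OF t] by (auto simp: analytic_at intro!: exI[of _ "ball 0 1"])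
  then have S: "gegen_arg t has_fps_expansion S"
    unfolding S_def by (rule analytic_at_imp_has_fps_expansion_0)
  then have S0: "fps_nth S 0 = 0"
    using has_fps_expansion_imp_0_eq_fps_nth_0[OF S] by (simp add: gegen_arg_def)
  have "(\<lambda>z. jacobi_gf \<alpha> g t z * (gegen c D \<mu> \<circ> gegen_arg t) z) has_fps_expansion J \<alpha> * (A oo S)"
    unfolding J_def A_def
    by (intro has_fps_expansion_mult has_fps_expansion_compose jacobi_gf_has_fps_expansion t
          gegen_has_fps_expansion S S0)
  then have F: "(\<lambda>z. jacobi_gf \<alpha> g t z * gegen c D \<mu> (gegen_arg t z)) has_fps_expansion J \<alpha> * (A oo S)"
    by (simp add: o_def)
  \<comment> \<open>The coefficients of \<open>S\<close> are never computed: only its powers times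
    \<open>J \<alpha>\<close> enter, and these follow from the functional identity by uniqueness of
    expansions.\<close>
  have JS: "J \<alpha> * S ^ m = fps_X ^ m * J (\<alpha> + 2 * real m)" for m
  proof (rule fps_expansion_unique_complex)
    show "(\<lambda>z. jacobi_gf \<alpha> g t z * gegen_arg t z ^ m) has_fps_expansion J \<alpha> * S ^ m"
      unfolding J_def by (intro fps_expansion_intros jacobi_gf_has_fps_expansion t S)
    have "(\<lambda>z. z ^ m * jacobi_gf (\<alpha> + 2 * real m) g t z) has_fps_expansion fps_X ^ m * J (\<alpha> + 2 * real m)"
      unfolding J_def by (intro fps_expansion_intros jacobi_gf_has_fps_expansion t)
    also have "?this \<longleftrightarrow> (\<lambda>z. jacobi_gf \<alpha> g t z * gegen_arg t z ^ m) has_fps_expansion fps_X ^ m * J (\<alpha> + 2 * real m)"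
      by (intro has_fps_expansion_cong eventually_mono[OF in_ball])
         (simp_all add: jacobi_gf_mult_gegen_arg_power[OF t])
    finally show "(\<lambda>z. jacobi_gf \<alpha> g t z * gegen_arg t z ^ m) has_fps_expansion fps_X ^ m * J (\<alpha> + 2 * real m)" .
  qed
  have nth: "fps_nth (J \<alpha> * (A oo S)) n
               = of_real (\<Sum>m\<le>n. gegen_coeff c D \<mu> m * shifted_jacobi (\<alpha> + 2 * real m) g (n - m) t)" for n
    unfolding fps_mult_compose_nth[OF S0] JS by (simp add: fps_X_power_mult_nth A_def J_def)
  have "(\<lambda>n. fps_nth (J \<alpha> * (A oo S)) n * z ^ n) sums (jacobi_gf \<alpha> g t z * gegen c D \<mu> (gegen_arg t z))"
    by (rule has_fps_expansion_imp_sums_complex[OF F, where r = 1])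
       (use z in \<open>auto intro!: holomorphic_intros jacobi_gf_holomorphic gegen_gegen_arg_holomorphic t D cD
          simp: one_ereal_def\<close>)
  then show ?thesis
    unfolding nth .
qed

lemma generating_function_real:
  fixes t r c D \<mu> \<alpha> g :: real
  assumes t: "0 \<le> t" "t \<le> 1" and D: "0 \<le> D" and cD: "c\<^sup>2 + D \<le> t\<^sup>2" and r: "0 < r" "r < 1"
  defines "R \<equiv> sqrt ((1 - r)\<^sup>2 + 4 * r * t)"
  defines "s \<equiv> 4 * r / (1 - r + R)\<^sup>2"
  shows "(\<lambda>n. (\<Sum>m\<le>n. gegen_coeff c D \<mu> m * shifted_jacobi (\<alpha> + 2 * real m) g (n - m) t) * r ^ n)
           sums ((2 / (1 - r + R)) powr \<alpha> * (2 / (1 + r + R)) powr g / R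
                  * ((1 - c * s)\<^sup>2 + D * s\<^sup>2) powr (- \<mu>))" (is "?f sums ?F")
    and "0 < 1 - c * s"
proof -
  have z: "norm (complex_of_real r) < 1"
    using r by simp
  have R: "jacobi_radical t (of_real r) = of_real R"
  proof -
    have "jacobi_radical t (of_real r) = csqrt (of_real ((1 - r)\<^sup>2 + 4 * r * t))"
      by (simp add: jacobi_radical_def)
    then show ?thesis
      using r t by (simp only: R_def csqrt_of_real add_nonneg_nonneg mult_nonneg_nonneg zero_le_power2
          zero_le_numeral less_imp_le)
  qed
  have "R > 0"
    using r t by (simp add: R_def add_pos_nonneg)
  have s: "gegen_arg t (of_real r) = of_real s"
    by (simp add: gegen_arg_def s_def R)
  have "(c\<^sup>2 + D) * (norm (of_real s :: complex))\<^sup>2 < 1"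
    using gegen_base_gegen_arg[OF t z cD] by (simp only: s)
  note gegen_base[OF D this]
  then show cs: "0 < 1 - c * s"
    by (auto simp: complex_nonpos_Reals_iff)
  have powr: "complex_of_real x powr of_real y = of_real (x powr y)" if "0 < x" for x y
    using that by (simp add: powr_of_real)
  \<comment> \<open>For real s both bases are positive, so the two split powers recombine into a
    single one.\<close>
  have "(1 - c * s) powr (- 2 * \<mu>) * (1 + D * s\<^sup>2 / (1 - c * s)\<^sup>2) powr (- \<mu>)
          = ((1 - c * s)\<^sup>2) powr (- \<mu>) * (1 + D * s\<^sup>2 / (1 - c * s)\<^sup>2) powr (- \<mu>)"
  proof -
    have "((1 - c * s)\<^sup>2) powr (- \<mu>) = ((1 - c * s) powr 2) powr (- \<mu>)"
      using cs by simp
    also have "\<dots> = (1 - c * s) powr (- 2 * \<mu>)"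
      by (subst powr_powr) simp
    finally show ?thesis
      by simp
  qed
  also have "\<dots> = ((1 - c * s)\<^sup>2 * (1 + D * s\<^sup>2 / (1 - c * s)\<^sup>2)) powr (- \<mu>)"
    using D by (subst powr_mult) auto
  also have "(1 - c * s)\<^sup>2 * (1 + D * s\<^sup>2 / (1 - c * s)\<^sup>2) = (1 - c * s)\<^sup>2 + D * s\<^sup>2"
    using cs by (simp add: field_simps)
  finally have G: "(1 - c * s) powr (- 2 * \<mu>) * (1 + D * s\<^sup>2 / (1 - c * s)\<^sup>2) powr (- \<mu>)
      = ((1 - c * s)\<^sup>2 + D * s\<^sup>2) powr (- \<mu>)" .
  have Dpos: "0 < 1 + D * s\<^sup>2 / (1 - c * s)\<^sup>2"
    using D by (intro add_pos_nonneg) auto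
  have "gegen c D \<mu> (of_real s) = of_real (1 - c * s) powr of_real (- 2 * \<mu>)
          * of_real (1 + D * s\<^sup>2 / (1 - c * s)\<^sup>2) powr of_real (- \<mu>)"
    by (simp add: gegen_def)
  also have "\<dots> = of_real (((1 - c * s)\<^sup>2 + D * s\<^sup>2) powr (- \<mu>))"
    unfolding powr[OF cs] powr[OF Dpos] G[symmetric] by simp
  finally have gegen: "gegen c D \<mu> (of_real s) = of_real (((1 - c * s)\<^sup>2 + D * s\<^sup>2) powr (- \<mu>))" .
  have pos: "0 < 2 / (1 - r + R)" "0 < 2 / (1 + r + R)"
    using r \<open>R > 0\<close> by auto
  have "jacobi_gf \<alpha> g t (of_real r) = of_real (2 / (1 - r + R)) powr of_real \<alpha>
          * of_real (2 / (1 + r + R)) powr of_real g / of_real R"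
    by (simp add: jacobi_gf_def R)
  also have "\<dots> = of_real ((2 / (1 - r + R)) powr \<alpha> * (2 / (1 + r + R)) powr g / R)"
    unfolding powr[OF pos(1)] powr[OF pos(2)] by simp
  finally have jacobi_gf: "jacobi_gf \<alpha> g t (of_real r) = of_real ((2 / (1 - r + R)) powr \<alpha> * (2 / (1 + r + R)) powr g / R)" .
  have "(\<lambda>n. complex_of_real (?f n)) sums complex_of_real ?F"
    using generating_function_complex[OF t D cD z, of \<mu> \<alpha> g]
    unfolding s gegen jacobi_gf by simp
  then show "?f sums ?F"
    by (simp only: sums_of_real_iff)
qed

subsection \<open>Rodrigues formulas\<close>

text \<open>The families are normalised as j-th derivatives over j!, which turns the Leibniz rule
  into a plain Cauchy product without binomial coefficients.\<close>

lemma higher_deriv_mult_divided: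
  fixes g h :: "nat \<Rightarrow> real \<Rightarrow> real"
  assumes "open S"
    and g: "\<And>j s. s \<in> S \<Longrightarrow> (g j has_real_derivative real (Suc j) * g (Suc j) s) (at s)"
    and h: "\<And>j s. s \<in> S \<Longrightarrow> (h j has_real_derivative real (Suc j) * h (Suc j) s) (at s)"
    and "s \<in> S"
  shows "(deriv ^^ N) (\<lambda>s. g 0 s * h 0 s) s = fact N * (\<Sum>j\<le>N. g j s * h (N - j) s)"
  using \<open>s \<in> S\<close>
proof (induction N arbitrary: s)
  case 0
  then show ?case
    by simp
next
  case (Suc N)
  have "eventually (\<lambda>s. s \<in> S) (nhds s)"
    using \<open>open S\<close> Suc.prems by (rule eventually_nhds_in_open)
  then have "deriv ((deriv ^^ N) (\<lambda>s. g 0 s * h 0 s)) s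
               = deriv (\<lambda>s. fact N * (\<Sum>j\<le>N. g j s * h (N - j) s)) s"
    using Suc.IH by (intro deriv_cong_ev refl) (auto elim: eventually_mono)
  also have "\<dots> = fact N * (\<Sum>j\<le>N. real (Suc j) * g (Suc j) s * h (N - j) s
                               + real (Suc (N - j)) * h (Suc (N - j)) s * g j s)"
    using Suc.prems by (intro DERIV_imp_deriv DERIV_cmult DERIV_sum DERIV_mult g h)
  \<comment> \<open>Both sums are reindexed over j \<le> N + 1; the boundary terms have weight 0,
    and the weights j and N + 1 - j then add up to the constant N + 1.\<close>
  also have "(\<Sum>j\<le>N. real (Suc j) * g (Suc j) s * h (N - j) s
                               + real (Suc (N - j)) * h (Suc (N - j)) s * g j s)
     = (\<Sum>j\<le>Suc N. real j * (g j s * h (Suc N - j) s)) + (\<Sum>j\<le>Suc N. real (Suc N - j) * (g j s * h (Suc N - j) s))"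
  proof -
    have "(\<Sum>j\<le>Suc N. real j * (g j s * h (Suc N - j) s)) = (\<Sum>j\<le>N. real (Suc j) * g (Suc j) s * h (N - j) s)"
      by (subst sum.atMost_Suc_shift) (simp add: mult.assoc)
    moreover have "(\<Sum>j\<le>Suc N. real (Suc N - j) * (g j s * h (Suc N - j) s))
        = (\<Sum>j\<le>N. real (Suc N - j) * (g j s * h (Suc N - j) s))"
      by simp
    moreover have "\<dots> = (\<Sum>j\<le>N. real (Suc (N - j)) * h (Suc (N - j)) s * g j s)"
      by (intro sum.cong refl) (simp add: Suc_diff_le mult_ac del: of_nat_Suc)
    ultimately show ?thesis
      by (simp add: sum.distrib)
  qed
  also have "\<dots> = (\<Sum>j\<le>Suc N. real (Suc N) * (g j s * h (Suc N - j) s))"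
    unfolding sum.distrib[symmetric]
    by (intro sum.cong refl) (simp add: of_nat_diff algebra_simps)
  also have "fact N * \<dots> = fact (Suc N) * (\<Sum>j\<le>Suc N. g j s * h (Suc N - j) s)"
    by (simp only: sum_distrib_left[symmetric] fact_Suc of_nat_mult mult_ac)
  finally show ?case
    by simp
qed

lemma gbinomial_diff_mult: "(p - real j) * (p gchoose j) = real (Suc j) * (p gchoose Suc j)"
  using gbinomial_mult_1[of p j] by (simp add: algebra_simps)

text \<open>Taking j derivatives of the first power and N - j of the second leaves the exponents
  \<alpha> + (N - j) and g + j, so the weight factors out of every Leibniz term.\<close>

lemma shifted_jacobi_Rodrigues:
  assumes t: "0 < t" "t < 1"
  shows "(deriv ^^ N) (\<lambda>s. s powr (real N + \<alpha>) * (1 - s) powr (real N + g)) t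
           = fact N * (t powr \<alpha> * (1 - t) powr g * shifted_jacobi \<alpha> g N t)"
proof -
  define p q where "p = real N + \<alpha>" and "q = real N + g"
  define G where "G = (\<lambda>j s. (p gchoose j) * s powr (p - real j))"
  define H where "H = (\<lambda>j s. (- 1) ^ j * (q gchoose j) * (1 - s) powr (q - real j))"
  have G: "(G j has_real_derivative real (Suc j) * G (Suc j) s) (at s)" if "s \<in> {0<..<1}" for j s
  proof -
    have "(G j has_real_derivative (p gchoose j) * ((p - real j) * s powr (p - real j - 1))) (at s)"
      unfolding G_def using that by (auto intro!: derivative_eq_intros)
    also have "(p gchoose j) * ((p - real j) * s powr (p - real j - 1))
        = ((p - real j) * (p gchoose j)) * s powr (p - real (Suc j))"
      by (simp add: algebra_simps)
    also have "\<dots> = real (Suc j) * G (Suc j) s"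
      unfolding G_def gbinomial_diff_mult by simp
    finally show ?thesis .
  qed
  have H: "(H j has_real_derivative real (Suc j) * H (Suc j) s) (at s)" if "s \<in> {0<..<1}" for j s
  proof -
    have "(H j has_real_derivative (- 1) ^ j * (q gchoose j) * ((q - real j) * (1 - s) powr (q - real j - 1) * (- 1))) (at s)"
      unfolding H_def using that by (auto intro!: derivative_eq_intros)
    also have "(- 1) ^ j * (q gchoose j) * ((q - real j) * (1 - s) powr (q - real j - 1) * (- 1))
        = (- 1) ^ Suc j * ((q - real j) * (q gchoose j)) * (1 - s) powr (q - real (Suc j))"
      by (simp add: algebra_simps)
    also have "\<dots> = real (Suc j) * H (Suc j) s"
      unfolding H_def gbinomial_diff_mult by simp
    finally show ?thesis .
  qed
  have "(deriv ^^ N) (\<lambda>s. G 0 s * H 0 s) t = fact N * (\<Sum>j\<le>N. G j t * H (N - j) t)"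
    using t by (intro higher_deriv_mult_divided[of "{0<..<1}"] G H) auto
  also have "(\<Sum>j\<le>N. G j t * H (N - j) t) = t powr \<alpha> * (1 - t) powr g * shifted_jacobi \<alpha> g N t"
    unfolding shifted_jacobi_def sum_distrib_left
  proof (intro sum.cong refl)
    fix j
    assume j: "j \<in> {..N}"
    have "t powr (p - real j) = t powr (\<alpha> + real (N - j))"
      using j by (simp add: p_def of_nat_diff algebra_simps)
    then have 1: "t powr (p - real j) = t powr \<alpha> * t ^ (N - j)"
      using t by (simp add: powr_add powr_realpow)
    have "(1 - t) powr (q - real (N - j)) = (1 - t) powr (g + real j)"
      using j by (simp add: q_def of_nat_diff algebra_simps)
    then have 2: "(1 - t) powr (q - real (N - j)) = (1 - t) powr g * (1 - t) ^ j"
      using t by (simp add: powr_add powr_realpow)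
    have 3: "(- t) ^ (N - j) = (- 1) ^ (N - j) * t ^ (N - j)"
      by (rule power_minus)
    show "G j t * H (N - j) t = t powr \<alpha> * (1 - t) powr g *
        ((real N + \<alpha> gchoose j) * (real N + g gchoose N - j) * (- t) ^ (N - j) * (1 - t) ^ j)"
      unfolding G_def H_def 1 2 3 p_def[symmetric] q_def[symmetric] by (simp only: mult_ac)
  qed
  finally show ?thesis
    by (simp add: G_def H_def p_def q_def)
qed

text \<open>
  Partial derivatives of \<open>(t\<^sup>2 - |x|\<^sup>2) powr a\<close> are encoded as polynomials in an extra indeterminate \<open>Z\<close>,
  where \<open>Z ^ L\<close> stands for the \<open>L\<close>-th derivative of \<open>w powr a\<close> at \<open>w = t\<^sup>2 - |x|\<^sup>2\<close>. In this encoding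
  the \<open>k\<close>-fold partial derivative in one coordinate multiplies by a Hermite polynomial scaled by \<open>Z\<close>,
  so mixed derivatives become products.
\<close>

fun hermite_poly :: "nat \<Rightarrow> real \<Rightarrow> real poly" where
  "hermite_poly 0 y = 1"
| "hermite_poly (Suc 0) y = monom (- 2 * y) 1"
| "hermite_poly (Suc (Suc n)) y = monom (- 2 * y) 1 * hermite_poly (Suc n) y + monom (- 2 * real (Suc n)) 1 * hermite_poly n y"

text \<open>One recurrence for all n: at n = 0 the truncated index n - 1 is harmless because its
  coefficient vanishes.\<close>

lemma hermite_poly_Suc:
  "hermite_poly (Suc n) y = monom (- 2 * y) 1 * hermite_poly n y + monom (- 2 * real n) 1 * hermite_poly (n - 1) y"
  by (cases n) (simp_all add: one_poly_def[symmetric])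

lemma degree_hermite_poly: "degree (hermite_poly n y) \<le> n"
proof (induction n y rule: hermite_poly.induct)
  case (2 y)
  show ?case
    by (simp add: degree_monom_le)
next
  case (3 n y)
  have "degree (monom (- 2 * y) 1 * hermite_poly (Suc n) y) \<le> Suc (Suc n)"
    using degree_mult_le[of "monom (- 2 * y) 1" "hermite_poly (Suc n) y"] degree_monom_le[of "- 2 * y" 1] 3 by linarith
  moreover have "degree (monom (- 2 * real (Suc n)) 1 * hermite_poly n y) \<le> Suc (Suc n)"
    using degree_mult_le[of "monom (- 2 * real (Suc n)) 1" "hermite_poly n y"] degree_monom_le[of "- 2 * real (Suc n)" 1] 3 by linarith
  ultimately show ?case
    by (simp add: degree_add_le)
qed simp

text \<open>The Appell property: the y-derivative of the n-th polynomial is -2nZ times the previous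
  one. The fixed factor P carries the other coordinates, and also makes the induction go
  through.\<close>

lemma coeff_hermite_poly_has_derivative:
  "((\<lambda>y. coeff (P * hermite_poly n y) L) has_real_derivative coeff (P * (monom (- 2 * real n) 1 * hermite_poly (n - 1) y)) L) (at y)"
proof (induction n y arbitrary: P L rule: hermite_poly.induct)
  case (1 y)
  show ?case
    by simp
next
  case (2 y)
  have "(\<lambda>y. coeff (P * hermite_poly (Suc 0) y) L) = (\<lambda>y. y * coeff (P * monom (- 2) 1) L)"
  proof
    fix y
    have "P * hermite_poly (Suc 0) y = smult y (P * monom (- 2) 1)"
      by (simp add: smult_monom flip: mult_smult_right)
    then show "coeff (P * hermite_poly (Suc 0) y) L = y * coeff (P * monom (- 2) 1) L"
      by simp
  qed
  then show ?case
    by (auto intro!: derivative_eq_intros)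
next
  case (3 n y)
  define Z where "Z = (monom (- 2) 1 :: real poly)"
  have Z: "monom (- 2 * r) 1 = smult r Z" for r
    by (simp add: Z_def smult_monom)
  have eq: "coeff (P * hermite_poly (Suc (Suc n)) y) L =
      y * coeff (P * Z * hermite_poly (Suc n) y) L + real (Suc n) * coeff (P * Z * hermite_poly n y) L" for y
  proof -
    have "P * hermite_poly (Suc (Suc n)) y = smult y (P * Z * hermite_poly (Suc n) y) + smult (real (Suc n)) (P * Z * hermite_poly n y)"
      unfolding hermite_poly.simps Z by (simp only: distrib_left mult_smult_left mult_smult_right mult_ac)
    then show ?thesis
      by simp
  qed
  have "((\<lambda>y. coeff (P * hermite_poly (Suc (Suc n)) y) L) has_real_derivative
      (1 * coeff (P * Z * hermite_poly (Suc n) y) L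
        + coeff (P * Z * (monom (- 2 * real (Suc n)) 1 * hermite_poly (Suc n - 1) y)) L * y)
      + real (Suc n) * coeff (P * Z * (monom (- 2 * real n) 1 * hermite_poly (n - 1) y)) L) (at y)"
    unfolding eq by (intro DERIV_add DERIV_mult DERIV_cmult DERIV_ident 3)
  also have "(1 * coeff (P * Z * hermite_poly (Suc n) y) L
        + coeff (P * Z * (monom (- 2 * real (Suc n)) 1 * hermite_poly (Suc n - 1) y)) L * y)
      + real (Suc n) * coeff (P * Z * (monom (- 2 * real n) 1 * hermite_poly (n - 1) y)) L
     = coeff (P * Z * hermite_poly (Suc n) y + smult (real (Suc n)) (P * Z * hermite_poly (Suc n) y)) L"
  proof -
    have "P * Z * hermite_poly (Suc n) y = smult y (P * Z * (Z * hermite_poly n y)) + smult (real n) (P * Z * (Z * hermite_poly (n - 1) y))"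
      unfolding hermite_poly_Suc Z by (simp only: distrib_left mult_smult_left mult_smult_right mult_ac)
    then show ?thesis
      unfolding Z by (simp add: algebra_simps)
  qed
  also have "P * Z * hermite_poly (Suc n) y + smult (real (Suc n)) (P * Z * hermite_poly (Suc n) y)
       = P * (monom (- 2 * real (Suc (Suc n))) 1 * hermite_poly (Suc (Suc n) - 1) y)"
  proof -
    have "P * Z * hermite_poly (Suc n) y + smult (real (Suc n)) (P * Z * hermite_poly (Suc n) y)
        = smult (1 + real (Suc n)) (P * Z * hermite_poly (Suc n) y)"
      by (simp only: smult_add_left smult_1_left)
    then show ?thesis
      unfolding Z by (simp add: mult_ac)
  qed
  finally show ?case .
qed

definition ffact_powr :: "real \<Rightarrow> nat \<Rightarrow> real \<Rightarrow> real" where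
  "ffact_powr a L w = fact L * (a gchoose L) * w powr (a - real L)"

lemma ffact_powr_has_derivative:
  "0 < w \<Longrightarrow> (ffact_powr a L has_real_derivative ffact_powr a (Suc L) w) (at w)"
proof -
  assume w: "0 < w"
  have "(ffact_powr a L has_real_derivative fact L * (a gchoose L) * ((a - real L) * w powr (a - real L - 1))) (at w)"
    unfolding ffact_powr_def using w by (auto intro!: derivative_eq_intros)
  also have "fact L * (a gchoose L) * ((a - real L) * w powr (a - real L - 1))
      = fact L * ((a - real L) * (a gchoose L)) * w powr (a - real (Suc L))"
    by (simp add: algebra_simps)
  also have "\<dots> = ffact_powr a (Suc L) w"
    unfolding gbinomial_diff_mult ffact_powr_def by (simp only: fact_Suc of_nat_mult mult_ac)
  finally show ?thesis .
qed

text \<open>The linear decoding map that sends Z^L to the L-th derivative of w powr a.\<close>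

definition peval :: "real \<Rightarrow> real poly \<Rightarrow> real \<Rightarrow> real" where
  "peval a P w = (\<Sum>L\<le>degree P. coeff P L * ffact_powr a L w)"

lemma peval_altdef: "degree P \<le> M \<Longrightarrow> peval a P w = (\<Sum>L\<le>M. coeff P L * ffact_powr a L w)"
  unfolding peval_def by (intro sum.mono_neutral_left) (auto simp: coeff_eq_0)

text \<open>Multiplication by Z decodes to one more derivative in w.\<close>

lemma peval_monom_mult: 
  "degree P \<le> M \<Longrightarrow> peval a (monom c 1 * P) w = (\<Sum>L\<le>M. c * coeff P L * ffact_powr a (Suc L) w)"
proof -
  assume "degree P \<le> M"
  then have "degree (monom c 1 * P) \<le> Suc M"
    using degree_mult_le[of "monom c 1" P] degree_monom_le[of c 1] by linarith
  then have "peval a (monom c 1 * P) w = (\<Sum>L\<le>Suc M. coeff (monom c 1 * P) L * ffact_powr a L w)"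
    by (rule peval_altdef)
  also have "\<dots> = (\<Sum>L\<le>M. c * coeff P L * ffact_powr a (Suc L) w)"
    by (subst sum.atMost_Suc_shift) (simp add: coeff_monom_mult)
  finally show ?thesis .
qed

lemma peval_add: "peval a (P + Q) w = peval a P w + peval a Q w"
proof -
  define M where "M = max (degree P) (degree Q)"
  have "degree (P + Q) \<le> M" "degree P \<le> M" "degree Q \<le> M"
    by (simp_all add: M_def degree_add_le_max)
  then show ?thesis
    by (simp add: peval_altdef algebra_simps sum.distrib)
qed

text \<open>The inner derivative of c - y^2 contributes -2yZ, the coefficients contribute -2nZ times
  the previous polynomial, and together these are the two terms of the Hermite recurrence.\<close>

lemma peval_hermite_poly_has_derivative:
  assumes w: "0 < c - y\<^sup>2"
  shows "((\<lambda>y. peval a (P * hermite_poly n y) (c - y\<^sup>2)) has_real_derivative peval a (P * hermite_poly (Suc n) y) (c - y\<^sup>2)) (at y)"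
proof -
  \<comment> \<open>The degree can drop at special y such as y = 0, so differentiating the sum
    requires a range that is uniform in y.\<close>
  define M where "M = degree P + n"
  have deg: "degree (P * hermite_poly n y) \<le> M" for y
    using degree_mult_le[of P "hermite_poly n y"] degree_hermite_poly[of n y] by (simp add: M_def)
  have deg': "degree (P * (monom (- 2 * real n) 1 * hermite_poly (n - 1) y)) \<le> M"
  proof (cases n)
    case (Suc k)
    then show ?thesis
      using degree_mult_le[of P "monom (- 2 * real n) 1 * hermite_poly (n - 1) y"]
        degree_mult_le[of "monom (- 2 * real n) 1" "hermite_poly (n - 1) y"]
        degree_monom_le[of "- 2 * real n" 1] degree_hermite_poly[of k y] by (simp add: M_def)
  qed simp
  have H: "((\<lambda>y. ffact_powr a L (c - y\<^sup>2)) has_real_derivative ffact_powr a (Suc L) (c - y\<^sup>2) * (- 2 * y)) (at y)" for L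
    by (rule DERIV_chain2[where f = "ffact_powr a L" and g = "\<lambda>y. c - y\<^sup>2", OF ffact_powr_has_derivative[OF w]])
       (auto intro!: derivative_eq_intros)
  have "((\<lambda>y. \<Sum>L\<le>M. coeff (P * hermite_poly n y) L * ffact_powr a L (c - y\<^sup>2)) has_real_derivative
      (\<Sum>L\<le>M. coeff (P * (monom (- 2 * real n) 1 * hermite_poly (n - 1) y)) L * ffact_powr a L (c - y\<^sup>2)
              + ffact_powr a (Suc L) (c - y\<^sup>2) * (- 2 * y) * coeff (P * hermite_poly n y) L)) (at y)"
    by (intro DERIV_sum DERIV_mult coeff_hermite_poly_has_derivative H)
  also have "(\<Sum>L\<le>M. coeff (P * (monom (- 2 * real n) 1 * hermite_poly (n - 1) y)) L * ffact_powr a L (c - y\<^sup>2)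
              + ffact_powr a (Suc L) (c - y\<^sup>2) * (- 2 * y) * coeff (P * hermite_poly n y) L)
      = peval a (P * (monom (- 2 * real n) 1 * hermite_poly (n - 1) y)) (c - y\<^sup>2)
        + peval a (monom (- 2 * y) 1 * (P * hermite_poly n y)) (c - y\<^sup>2)"
    unfolding peval_monom_mult[OF deg] peval_altdef[OF deg'] sum.distrib by (simp add: mult_ac)
  also have "\<dots> = peval a (P * hermite_poly (Suc n) y) (c - y\<^sup>2)"
    unfolding peval_add[symmetric] hermite_poly_Suc by (simp only: distrib_left mult_ac add_ac)
  finally show ?thesis
    by (simp only: peval_altdef[OF deg])
qed

text \<open>P may depend on every coordinate except the i-th. The formula for F is known only in the
  ball, which suffices because derivatives depend on germs.\<close>

lemma partial_deriv_peval:
  fixes P :: "real^'d::finite \<Rightarrow> real poly"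
  assumes P: "\<And>y s. P (y + s *\<^sub>R axis i 1) = P y"
    and F: "\<And>y. norm y < t \<Longrightarrow> F y = peval a (P y) (t\<^sup>2 - (norm y)\<^sup>2)"
    and y: "norm y < t"
  shows "(partial_deriv i ^^ n) F y = peval a (P y * hermite_poly n (y $ i)) (t\<^sup>2 - (norm y)\<^sup>2)"
  using y
proof (induction n arbitrary: y)
  case 0
  then show ?case
    by (simp add: F)
next
  case (Suc n)
  \<comment> \<open>\<open>c\<close> is t^2 minus the squares of the other coordinates, hence
    constant along the i-th direction.\<close>
  define c where "c = t\<^sup>2 - (norm y)\<^sup>2 + (y $ i)\<^sup>2"
  have norm: "t\<^sup>2 - (norm (y + s *\<^sub>R axis i 1))\<^sup>2 = c - (y $ i + s)\<^sup>2" for s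
  proof -
    have "(norm (y + s *\<^sub>R axis i 1))\<^sup>2 = (norm y)\<^sup>2 + 2 * s * (y $ i) + s\<^sup>2"
      unfolding power2_norm_eq_inner
      by (simp add: inner_add_left inner_add_right inner_axis inner_axis' inner_axis_axis power2_eq_square algebra_simps)
    then show ?thesis
      by (simp add: c_def power2_eq_square algebra_simps)
  qed
  have "((\<lambda>s. norm (y + s *\<^sub>R axis i 1)) \<longlongrightarrow> norm (y + 0 *\<^sub>R axis i 1)) (nhds 0)"
    by (intro tendsto_intros filterlim_ident)
  then have "eventually (\<lambda>s. norm (y + s *\<^sub>R axis i 1) < t) (nhds 0)"
    using Suc.prems by (intro order_tendstoD(2)) auto
  then have "eventually (\<lambda>s. (partial_deriv i ^^ n) F (y + s *\<^sub>R axis i 1)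
      = peval a (P y * hermite_poly n (y $ i + s)) (c - (y $ i + s)\<^sup>2)) (nhds 0)"
    by eventually_elim (simp add: Suc.IH P norm)
  then have "(partial_deriv i ^^ Suc n) F y = deriv (\<lambda>s. peval a (P y * hermite_poly n (y $ i + s)) (c - (y $ i + s)\<^sup>2)) 0"
    unfolding funpow.simps o_def partial_deriv_def by (intro deriv_cong_ev refl)
  also have "\<dots> = peval a (P y * hermite_poly (Suc n) (y $ i + 0)) (c - (y $ i + 0)\<^sup>2) * 1"
  proof (rule DERIV_imp_deriv)
    have "0 < t\<^sup>2 - (norm y)\<^sup>2"
      using Suc.prems by (simp add: power_strict_mono)
    then have "0 < c - (y $ i + 0)\<^sup>2"
      by (simp add: c_def)
    then show "((\<lambda>s. peval a (P y * hermite_poly n (y $ i + s)) (c - (y $ i + s)\<^sup>2)) has_real_derivative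
        peval a (P y * hermite_poly (Suc n) (y $ i + 0)) (c - (y $ i + 0)\<^sup>2) * 1) (at 0)"
      by (intro DERIV_chain2[OF peval_hermite_poly_has_derivative]) (auto intro!: derivative_eq_intros)
  qed
  also have "\<dots> = peval a (P y * hermite_poly (Suc n) (y $ i)) (t\<^sup>2 - (norm y)\<^sup>2)"
    by (simp add: c_def)
  finally show ?case .
qed

text \<open>Distinctness of the list ensures that the factors already produced are constant in the
  next coordinate. The resulting product is the same whichever enumeration the choice operator
  picks.\<close>

lemma mixed_partial_powr:
  fixes y :: "real^'d::finite"
  assumes "norm y < t"
  shows "mixed_partial k (\<lambda>y. (t\<^sup>2 - (norm y)\<^sup>2) powr a) y
           = peval a (\<Prod>i\<in>UNIV. hermite_poly (k i) (y $ i)) (t\<^sup>2 - (norm y)\<^sup>2)"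
proof -
  have foldr: "foldr (\<lambda>i. partial_deriv i ^^ k i) is (\<lambda>y. (t\<^sup>2 - (norm y)\<^sup>2) powr a) y
           = peval a (\<Prod>i\<in>set is. hermite_poly (k i) (y $ i)) (t\<^sup>2 - (norm y)\<^sup>2)"
    if "distinct is" "norm y < t" for "is" and y :: "real^'d"
    using that
  proof (induction "is" arbitrary: y)
    case Nil
    then show ?case
      by (simp add: peval_def ffact_powr_def)
  next
    case (Cons i "is")
    have "(partial_deriv i ^^ k i) (foldr (\<lambda>i. partial_deriv i ^^ k i) is (\<lambda>y. (t\<^sup>2 - (norm y)\<^sup>2) powr a)) y
      = peval a ((\<Prod>j\<in>set is. hermite_poly (k j) (y $ j)) * hermite_poly (k i) (y $ i)) (t\<^sup>2 - (norm y)\<^sup>2)"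
    proof (rule partial_deriv_peval)
      show "(\<Prod>j\<in>set is. hermite_poly (k j) ((z + s *\<^sub>R axis i 1) $ j)) = (\<Prod>j\<in>set is. hermite_poly (k j) (z $ j))"
        for z :: "real^'d" and s
        using Cons.prems by (intro prod.cong refl) (auto simp: axis_def)
    qed (use Cons in auto)
    then show ?case
      using Cons.prems by (simp add: mult.commute)
  qed
  define xs :: "'d list" where "xs = (SOME is. distinct is \<and> set is = UNIV)"
  have "\<exists>is :: 'd list. distinct is \<and> set is = UNIV"
    using finite_distinct_list[of "UNIV :: 'd set"] by auto
  then have "distinct xs \<and> set xs = UNIV"
    unfolding xs_def by (rule someI_ex)
  then show ?thesis
    using foldr[of xs y] assms unfolding mixed_partial_def xs_def[symmetric] by simp
qed

subsection \<open>Summation over multi-indices\<close>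

lemma fps_deriv_linear_unique:
  fixes F G A :: "'a::{idom,ring_char_0} fps"
  assumes "fps_deriv F = A * F" "fps_deriv G = A * G" "fps_nth F 0 = fps_nth G 0"
  shows "F = G"
proof (rule fps_ext)
  fix n
  show "fps_nth F n = fps_nth G n"
  proof (induction n rule: less_induct)
    case (less n)
    show ?case
    proof (cases n)
      case 0
      then show ?thesis
        using assms(3) by simp
    next
      case (Suc m)
      have "of_nat (Suc m) * fps_nth F (Suc m) = (\<Sum>i=0..m. fps_nth A i * fps_nth F (m - i))"
        using arg_cong[OF assms(1), of "\<lambda>F. fps_nth F m"] by (simp add: fps_mult_nth)
      also have "\<dots> = (\<Sum>i=0..m. fps_nth A i * fps_nth G (m - i))"
        using less.IH Suc by (intro sum.cong refl) auto
      also have "\<dots> = of_nat (Suc m) * fps_nth G (Suc m)"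
        using arg_cong[OF assms(2), of "\<lambda>F. fps_nth F m"] by (simp add: fps_mult_nth)
      finally show ?thesis
        using Suc by (simp only: mult_cancel_left of_nat_eq_0_iff) simp
    qed
  qed
qed

lemma fps_deriv_prod_linear:
  fixes F A :: "'i \<Rightarrow> 'a::comm_ring_1 fps"
  assumes "\<And>i. i \<in> I \<Longrightarrow> fps_deriv (F i) = A i * F i"
  shows "fps_deriv (\<Prod>i\<in>I. F i) = (\<Sum>i\<in>I. A i) * (\<Prod>i\<in>I. F i)"
  using assms by (induction I rule: infinite_finite_induct) (auto simp: algebra_simps)

text \<open>The series exp(u X) with u in the ring of polynomials in Z.\<close>

definition fps_exp_poly :: "real poly \<Rightarrow> real poly fps" where
  "fps_exp_poly u = Abs_fps (\<lambda>n. smult (1 / fact n) (u ^ n))"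

lemma fps_deriv_exp_poly: "fps_deriv (fps_exp_poly u) = fps_const u * fps_exp_poly u"
proof (rule fps_ext)
  fix n
  have "fps_nth (fps_deriv (fps_exp_poly u)) n = smult (real (Suc n)) (smult (1 / fact (Suc n)) (u ^ Suc n))"
    by (simp add: fps_exp_poly_def of_nat_poly del: of_nat_Suc of_nat_add)
  also have "\<dots> = smult (1 / fact n) (u ^ Suc n)"
    by (simp add: field_simps del: of_nat_Suc)
  finally show "fps_nth (fps_deriv (fps_exp_poly u)) n = fps_nth (fps_const u * fps_exp_poly u) n"
    by (simp add: fps_exp_poly_def)
qed

text \<open>The logarithmic derivative of exp(-2 c Z X - B Z X^2). It is additive in c and B, so a
  product over coordinates only adds up the parameters.\<close>

definition hermite_rate :: "real \<Rightarrow> real \<Rightarrow> real poly fps" where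
  "hermite_rate c B = fps_const (monom (- 2 * c) 1) + fps_const (monom (- 2 * B) 1) * fps_X"

lemma hermite_rate_sum:
  "(\<Sum>i\<in>I. hermite_rate (c i) (B i)) = hermite_rate (\<Sum>i\<in>I. c i) (\<Sum>i\<in>I. B i)"
proof (induction I rule: infinite_finite_induct)
  case (insert i I)
  have "monom (- 2 * (c + c')) 1 = monom (- 2 * c) 1 + monom (- 2 * c') (1::nat)" for c c' :: real
    by (simp add: add_monom)
  with insert show ?case
    by (simp add: hermite_rate_def algebra_simps flip: fps_const_add)
qed (simp_all add: hermite_rate_def)

definition hermite_fps :: "real \<Rightarrow> real \<Rightarrow> real poly fps" where
  "hermite_fps b y = Abs_fps (\<lambda>k. smult (b ^ k / fact k) (hermite_poly k y))"

text \<open>Compared coefficientwise, this equation is the three-term recurrence of the Hermite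
  polynomials.\<close>

lemma fps_deriv_hermite: "fps_deriv (hermite_fps b y) = hermite_rate (b * y) (b\<^sup>2) * hermite_fps b y"
proof (rule fps_ext)
  fix n
  have m: "monom (- 2 * (b * y)) 1 = smult b (monom (- 2 * y) (1::nat))"
    "monom (- 2 * b\<^sup>2) 1 = smult (b\<^sup>2) (monom (- 2) (1::nat))"
    "monom (- 2 * real n) 1 = smult (real n) (monom (- 2) (1::nat))"
    by (simp_all add: smult_monom mult_ac)
  have "fps_nth (fps_deriv (hermite_fps b y)) n
      = smult (real (Suc n)) (smult (b ^ Suc n / fact (Suc n)) (hermite_poly (Suc n) y))"
    by (simp add: hermite_fps_def of_nat_poly del: of_nat_Suc of_nat_add hermite_poly.simps)
  also have "\<dots> = smult (b ^ Suc n / fact n) (hermite_poly (Suc n) y)"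
    by (simp add: field_simps del: of_nat_Suc hermite_poly.simps)
  also have "\<dots> = fps_nth (hermite_rate (b * y) (b\<^sup>2) * hermite_fps b y) n"
  proof (cases n)
    case 0
    then show ?thesis
      by (simp add: hermite_rate_def hermite_fps_def distrib_right mult.assoc smult_monom mult_ac)
  next
    case (Suc k)
    have "fps_nth (hermite_rate (b * y) (b\<^sup>2) * hermite_fps b y) n
        = monom (- 2 * (b * y)) 1 * smult (b ^ n / fact n) (hermite_poly n y)
          + monom (- 2 * b\<^sup>2) 1 * smult (b ^ k / fact k) (hermite_poly k y)"
      by (simp add: hermite_rate_def hermite_fps_def distrib_right mult.assoc Suc del: hermite_poly.simps)
    also have "\<dots> = smult (b ^ Suc n / fact n) (monom (- 2 * y) 1 * hermite_poly n y)
          + smult (b ^ Suc n / fact n * real n) (monom (- 2) 1 * hermite_poly k y)"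
      unfolding m(1,2) by (simp add: Suc power2_eq_square divide_simps mult_ac del: hermite_poly.simps of_nat_Suc)
    also have "\<dots> = smult (b ^ Suc n / fact n) (hermite_poly (Suc n) y)"
      unfolding hermite_poly_Suc m(3) by (simp add: Suc smult_add_right del: hermite_poly.simps of_nat_Suc)
    finally show ?thesis ..
  qed
  finally show "fps_nth (fps_deriv (hermite_fps b y)) n = fps_nth (hermite_rate (b * y) (b\<^sup>2) * hermite_fps b y) n" .
qed

text \<open>Both sides have constant term 1 and the same logarithmic derivative. With y = x the two
  sums become the inner product of b and x and the square of |b|.\<close>

lemma hermite_fps_prod:
  "(\<Prod>i\<in>I. hermite_fps (b i) (y i))
     = fps_exp_poly (monom (- 2 * (\<Sum>i\<in>I. b i * y i)) 1)
       * (fps_exp_poly (monom (- (\<Sum>i\<in>I. (b i)\<^sup>2)) 1) oo fps_X\<^sup>2)"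
proof (rule fps_deriv_linear_unique)
  define u v :: "real poly"
    where "u = monom (- 2 * (\<Sum>i\<in>I. b i * y i)) 1" and "v = monom (- (\<Sum>i\<in>I. (b i)\<^sup>2)) 1"
  define A where "A = hermite_rate (\<Sum>i\<in>I. b i * y i) (\<Sum>i\<in>I. (b i)\<^sup>2)"
  show "fps_deriv (\<Prod>i\<in>I. hermite_fps (b i) (y i)) = A * (\<Prod>i\<in>I. hermite_fps (b i) (y i))"
    unfolding A_def hermite_rate_sum[symmetric] by (intro fps_deriv_prod_linear fps_deriv_hermite)
  have X2: "fps_nth (fps_X\<^sup>2 :: real poly fps) 0 = 0"
    by simp
  have "2 * v = monom (- 2 * (\<Sum>i\<in>I. (b i)\<^sup>2)) 1"
    by (simp add: v_def numeral_poly monom_0[symmetric] mult_monom)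
  then have A: "A = fps_const u + fps_const (2 * v) * fps_X"
    by (simp add: A_def hermite_rate_def u_def)
  have "fps_deriv (fps_exp_poly v oo fps_X\<^sup>2) = fps_const (2 * v) * fps_X * (fps_exp_poly v oo fps_X\<^sup>2)"
    unfolding fps_compose_deriv[OF X2] fps_deriv_exp_poly
    by (simp add: fps_compose_mult_distrib fps_deriv_power mult_ac fps_numeral_fps_const flip: fps_const_mult)
  then show "fps_deriv (fps_exp_poly u * (fps_exp_poly v oo fps_X\<^sup>2)) = A * (fps_exp_poly u * (fps_exp_poly v oo fps_X\<^sup>2))"
    by (simp add: fps_deriv_exp_poly A algebra_simps)
  have "fps_nth (\<Prod>i\<in>I. hermite_fps (b i) (y i)) 0 = 1"
    by (induction I rule: infinite_finite_induct) (simp_all add: hermite_fps_def)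
  then show "fps_nth (\<Prod>i\<in>I. hermite_fps (b i) (y i)) 0 = fps_nth (fps_exp_poly u * (fps_exp_poly v oo fps_X\<^sup>2)) 0"
    by (simp add: fps_exp_poly_def)
qed

lemma fps_exp_poly_monom_nth:
  "fps_nth (fps_exp_poly (monom p 1) * (fps_exp_poly (monom q 1) oo fps_X\<^sup>2)) m
     = (\<Sum>j\<le>m div 2. monom (p ^ (m - 2 * j) * q ^ j / (fact j * fact (m - 2 * j))) (m - j))"
proof -
  have X2: "fps_nth (fps_X\<^sup>2 :: real poly fps) 0 = 0"
    by simp
  have "fps_nth (fps_exp_poly (monom p 1) * (fps_exp_poly (monom q 1) oo fps_X\<^sup>2)) m
      = (\<Sum>j\<le>m. smult (1 / fact j) (monom q 1 ^ j) *
           (if m < 2 * j then 0 else smult (1 / fact (m - 2 * j)) (monom p 1 ^ (m - 2 * j))))"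
    unfolding fps_mult_compose_nth[OF X2]
    by (simp add: fps_exp_poly_def fps_X_power_mult_right_nth cong: if_cong flip: power_mult)
  also have "\<dots> = (\<Sum>j\<le>m div 2. smult (1 / fact j) (monom q 1 ^ j) *
           (smult (1 / fact (m - 2 * j)) (monom p 1 ^ (m - 2 * j))))"
    by (intro sum.mono_neutral_cong_right) (auto simp: mult_ac)
  also have "\<dots> = (\<Sum>j\<le>m div 2. monom (p ^ (m - 2 * j) * q ^ j / (fact j * fact (m - 2 * j))) (m - j))"
  proof (intro sum.cong refl)
    fix j
    assume "j \<in> {..m div 2}"
    then have "j + (m - 2 * j) = m - j"
      by auto
    then show "smult (1 / fact j) (monom q 1 ^ j) * (smult (1 / fact (m - 2 * j)) (monom p 1 ^ (m - 2 * j)))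
        = monom (p ^ (m - 2 * j) * q ^ j / (fact j * fact (m - 2 * j))) (m - j)"
      by (simp add: monom_power smult_monom mult_monom mult_ac)
  qed
  finally show ?thesis .
qed

text \<open>Multi-indices of weight m are the multiplicity functions of multisets of size m, over
  which the coefficient of a product is expanded.\<close>

lemma fps_nth_prod_mi:
  fixes F :: "'d::finite \<Rightarrow> 'a::comm_ring_1 fps"
  shows "fps_nth (\<Prod>i\<in>UNIV. F i) m = (\<Sum>k | mi_abs k = m. \<Prod>i\<in>UNIV. fps_nth (F i) (k i))"
proof -
  have "(\<Sum>k | mi_abs k = m. \<Prod>i\<in>UNIV. fps_nth (F i) (k i))
      = (\<Sum>X\<in>multisets_of_size UNIV m. \<Prod>i\<in>UNIV. fps_nth (F i) (count X i))"
  proof (rule sum.reindex_bij_witness[of _ count Abs_multiset])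
    fix k :: "'d \<Rightarrow> nat"
    have count: "count (Abs_multiset k) = k"
      by (rule count_Abs_multiset) simp
    show "count (Abs_multiset k) = k"
      by (rule count)
    show "(\<Prod>i\<in>UNIV. fps_nth (F i) (count (Abs_multiset k) i)) = (\<Prod>i\<in>UNIV. fps_nth (F i) (k i))"
      by (simp only: count)
    assume "k \<in> {k. mi_abs k = m}"
    moreover have "size (Abs_multiset k) = mi_abs k"
      unfolding size_multiset_overloaded_eq mi_abs_def count
      by (rule sum.mono_neutral_left) (auto simp: count not_in_iff)
    ultimately show "Abs_multiset k \<in> multisets_of_size UNIV m"
      by (simp add: multisets_of_size_def)
  next
    fix X :: "'d multiset"
    assume "X \<in> multisets_of_size UNIV m"
    moreover have "mi_abs (count X) = size X"
      unfolding size_multiset_overloaded_eq mi_abs_def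
      by (rule sum.mono_neutral_right) (auto simp: not_in_iff)
    ultimately show "count X \<in> {k. mi_abs k = m}"
      by (simp add: multisets_of_size_def)
  qed (simp add: count_inverse)
  then show ?thesis
    by (simp add: fps_prod_nth')
qed

lemma prod_smult: "(\<Prod>i\<in>I. smult (c i) (P i)) = smult (\<Prod>i\<in>I. c i) (\<Prod>i\<in>I. P i :: 'a::comm_ring_1 poly)"
  by (induction I rule: infinite_finite_induct) (simp_all add: mult_ac)

lemma hermite_poly_multinomial_sum:
  fixes b x :: "real^'d::finite"
  shows "(\<Sum>k | mi_abs k = m. smult (mi_power b k / mi_fact k) (\<Prod>i\<in>UNIV. hermite_poly (k i) (x $ i)))
     = (\<Sum>j\<le>m div 2. monom ((- 2 * (b \<bullet> x)) ^ (m - 2 * j) * (- ((norm b)\<^sup>2)) ^ j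
                           / (fact j * fact (m - 2 * j))) (m - j))"
proof -
  have c: "(\<Sum>i\<in>UNIV. b $ i * x $ i) = b \<bullet> x"
    by (simp add: inner_vec_def)
  have B: "(\<Sum>i\<in>UNIV. (b $ i)\<^sup>2) = (norm b)\<^sup>2"
    by (simp add: power2_norm_eq_inner inner_vec_def flip: power2_eq_square)
  have "(\<Sum>k | mi_abs k = m. smult (mi_power b k / mi_fact k) (\<Prod>i\<in>UNIV. hermite_poly (k i) (x $ i)))
      = fps_nth (\<Prod>i\<in>UNIV. hermite_fps (b $ i) (x $ i)) m"
    unfolding fps_nth_prod_mi
    by (simp add: hermite_fps_def prod_smult mi_power_def mi_fact_def prod_dividef)
  also have "fps_nth (\<Prod>i\<in>UNIV. hermite_fps (b $ i) (x $ i)) m =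
      fps_nth (fps_exp_poly (monom (- 2 * (b \<bullet> x)) 1) * (fps_exp_poly (monom (- ((norm b)\<^sup>2)) 1) oo fps_X\<^sup>2)) m"
    unfolding hermite_fps_prod B c ..
  finally show ?thesis
    unfolding fps_exp_poly_monom_nth .
qed

text \<open>The identity holds for each j. The falling factorial is (\<mu> + 1/2)_m / (\<mu> +
  1/2)_j, which cancels the denominator, and the duplication formula for (2\<mu>)_(2j) supplies
  (\<mu>)_j and the remaining factor. The bound on \<mu> keeps all these denominators
  positive.\<close>

lemma gegen_coeff_identity:
  fixes \<mu> c B Q :: real
  assumes \<mu>: "\<mu> > - 1/2"
  shows "(- 1) ^ m * pochhammer (2 * \<mu>) m / (2 ^ m * pochhammer (\<mu> + 1/2) m)
           * (\<Sum>j\<le>m div 2. (- 2 * c) ^ (m - 2 * j) * (- B) ^ j / (fact j * fact (m - 2 * j))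
                * (fact (m - j) * ((real m + \<mu> - 1/2) gchoose (m - j)) * Q ^ j))
         = gegen_coeff c (B * Q) \<mu> m"
  unfolding gegen_coeff_def sum_distrib_left
proof (intro sum.cong refl)
  fix j
  assume "j \<in> {..m div 2}"
  then have j: "2 * j \<le> m" "j \<le> m"
    by auto
  define i where "i = m - 2 * j"
  have m: "m = i + 2 * j"
    using j by (simp add: i_def)
  have pos: "pochhammer (\<mu> + 1/2) n > 0" for n
    using \<mu> by (intro pochhammer_pos) auto
  have 1: "fact (m - j) * ((real m + \<mu> - 1/2) gchoose (m - j)) = pochhammer (\<mu> + 1/2) m / pochhammer (\<mu> + 1/2) j"
  proof -
    have "fact (m - j) * ((real m + \<mu> - 1/2) gchoose (m - j)) = pochhammer (\<mu> + 1/2 + real j) (m - j)"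
      using j by (simp add: gbinomial_pochhammer' of_nat_diff algebra_simps)
    then show ?thesis
      using pochhammer_product[OF j(2), of "\<mu> + 1/2"] pos[of j] by (simp add: field_simps)
  qed
  have 2: "(- \<mu>) gchoose j = (- 1) ^ j * pochhammer \<mu> j / fact j"
    by (simp add: gbinomial_pochhammer)
  have 3: "(- 2 * \<mu> - 2 * real j) gchoose (m - 2 * j) = (- 1) ^ i * pochhammer (2 * \<mu> + 2 * real j) i / fact i"
    by (simp add: gbinomial_pochhammer i_def add.commute)
  have 4: "pochhammer (2 * \<mu>) m = 4 ^ j * pochhammer \<mu> j * pochhammer (\<mu> + 1/2) j * pochhammer (2 * \<mu> + 2 * real j) i"
  proof -
    have "pochhammer (2 * \<mu>) m = pochhammer (2 * \<mu>) (2 * j) * pochhammer (2 * \<mu> + 2 * real j) i"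
      unfolding i_def pochhammer_product[OF j(1)] by simp
    then show ?thesis
      by (simp only: pochhammer_double) (simp add: power_mult)
  qed
  have 5: "(- 1) ^ m / 2 ^ m * (- 2 * c) ^ i * (- B) ^ j * 4 ^ j = (- 1) ^ j * (- 1) ^ i * (- c) ^ i * B ^ j"
  proof -
    have "(- 1 :: real) ^ m = (- 1) ^ i" "(2 :: real) ^ m = 2 ^ i * 4 ^ j"
      by (simp_all add: m power_add power_mult)
    moreover have "(- 2 * c) ^ i = (- 1) ^ i * 2 ^ i * c ^ i"
      by (simp flip: power_mult_distrib)
    moreover have "(- c) ^ i = (- 1) ^ i * c ^ i" "(- B) ^ j = (- 1) ^ j * B ^ j"
      by (simp_all flip: power_mult_distrib)
    ultimately show ?thesis
      by simp
  qed
  have "(- 1) ^ m * pochhammer (2 * \<mu>) m / (2 ^ m * pochhammer (\<mu> + 1/2) m) *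
       ((- 2 * c) ^ i * (- B) ^ j / (fact j * fact i) *
         (pochhammer (\<mu> + 1/2) m / pochhammer (\<mu> + 1/2) j * Q ^ j))
      = ((- 1) ^ m / 2 ^ m * (- 2 * c) ^ i * (- B) ^ j * 4 ^ j)
         * (pochhammer \<mu> j / fact j * (pochhammer (2 * \<mu> + 2 * real j) i / fact i) * Q ^ j)"
    unfolding 4 using pos[of j] pos[of m] by (simp add: field_simps)
  also have "\<dots> = ((- 1) ^ j * pochhammer \<mu> j / fact j) * ((- 1) ^ i * pochhammer (2 * \<mu> + 2 * real j) i / fact i)
        * (- c) ^ i * (B * Q) ^ j"
    unfolding 5 by (simp add: power_mult_distrib)
  finally show "(- 1) ^ m * pochhammer (2 * \<mu>) m / (2 ^ m * pochhammer (\<mu> + 1/2) m) *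
       ((- 2 * c) ^ (m - 2 * j) * (- B) ^ j / (fact j * fact (m - 2 * j)) *
         (fact (m - j) * ((real m + \<mu> - 1/2) gchoose (m - j)) * Q ^ j))
      = ((- \<mu>) gchoose j) * ((- 2 * \<mu> - 2 * real j) gchoose (m - 2 * j)) * (- c) ^ (m - 2 * j) * (B * Q) ^ j"
    unfolding 1 2 3 i_def .
qed

subsection \<open>The polynomials on the cone\<close>

text \<open>The Rodrigues expression after cancelling the weights. The Hermite product has degree at
  most |k| in Z, so no term with a negative power of t^2 - |x|^2 is lost by stopping at L =
  |k|.\<close>

definition UJ_poly :: "real \<Rightarrow> real \<Rightarrow> real \<Rightarrow> ('d::finite \<Rightarrow> nat) \<Rightarrow> nat \<Rightarrow> (real^'d) \<times> real \<Rightarrow> real" where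
  "UJ_poly \<beta> \<gamma> \<mu> k n z =
     (\<Sum>L\<le>mi_abs k. coeff (\<Prod>i\<in>UNIV. hermite_poly (k i) (fst z $ i)) L
          * (fact L * ((real (mi_abs k) + \<mu> - 1/2) gchoose L) * ((snd z)\<^sup>2 - (norm (fst z))\<^sup>2) ^ (mi_abs k - L)))
     * (fact (n - mi_abs k)
        * shifted_jacobi (2 * \<mu> + \<beta> + real CARD('d) - 1 + 2 * real (mi_abs k)) \<gamma> (n - mi_abs k) (snd z))"

lemma degree_prod_hermite_poly: "degree (\<Prod>i\<in>UNIV. hermite_poly (k i) (y i)) \<le> mi_abs k"
proof -
  have "degree (\<Prod>i\<in>UNIV. hermite_poly (k i) (y i)) \<le> sum (degree \<circ> (\<lambda>i. hermite_poly (k i) (y i))) UNIV"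
    by (rule degree_prod_sum_le) simp
  also have "\<dots> \<le> mi_abs k"
    unfolding mi_abs_def by (intro sum_mono) (simp add: degree_hermite_poly)
  finally show ?thesis .
qed

lemma UJ_formula_eq_poly:
  fixes x :: "real^'d::finite"
  assumes k: "mi_abs k \<le> n" and x: "norm x < t" and t: "t < 1"
  shows "UJ_formula \<beta> \<gamma> \<mu> k n x t = UJ_poly \<beta> \<gamma> \<mu> k n (x, t)"
proof -
  define m N where "m = mi_abs k" and "N = n - m"
  define d where "d = real CARD('d)"
  define Q where "Q = t\<^sup>2 - (norm x)\<^sup>2"
  define a where "a = 2 * \<mu> + \<beta> + d - 1 + 2 * real m"
  define S where "S = (\<Sum>L\<le>m. coeff (\<Prod>i\<in>UNIV. hermite_poly (k i) (x $ i)) L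
          * (fact L * ((real m + \<mu> - 1/2) gchoose L) * Q ^ (m - L)))"
  have t0: "0 < t"
    using x norm_ge_zero[of x] by linarith
  have Q: "0 < Q"
    using x by (simp add: Q_def power_strict_mono)
  have n: "real n = real N + real m"
    using k by (simp add: N_def m_def of_nat_diff)
  have "mixed_partial k (\<lambda>y. (t\<^sup>2 - (norm y)\<^sup>2) powr (real m + \<mu> - 1/2)) x
      = (\<Sum>L\<le>m. coeff (\<Prod>i\<in>UNIV. hermite_poly (k i) (x $ i)) L * ffact_powr (real m + \<mu> - 1/2) L Q)"
    unfolding mixed_partial_powr[OF x] Q_def[symmetric] m_def by (rule peval_altdef[OF degree_prod_hermite_poly])
  also have "\<dots> = Q powr (\<mu> - 1/2) * S"
    unfolding S_def sum_distrib_left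
  proof (intro sum.cong refl)
    fix L
    assume "L \<in> {..m}"
    then have "real m + \<mu> - 1/2 - real L = (\<mu> - 1/2) + real (m - L)"
      by (simp add: of_nat_diff)
    then have "Q powr (real m + \<mu> - 1/2 - real L) = Q powr (\<mu> - 1/2) * Q ^ (m - L)"
      using Q by (simp only: powr_add powr_realpow)
    then show "coeff (\<Prod>i\<in>UNIV. hermite_poly (k i) (x $ i)) L * ffact_powr (real m + \<mu> - 1/2) L Q =
         Q powr (\<mu> - 1/2) * (coeff (\<Prod>i\<in>UNIV. hermite_poly (k i) (x $ i)) L
          * (fact L * ((real m + \<mu> - 1/2) gchoose L) * Q ^ (m - L)))"
      by (simp add: ffact_powr_def)
  qed
  finally have space: "mixed_partial k (\<lambda>y. (t\<^sup>2 - (norm y)\<^sup>2) powr (real m + \<mu> - 1/2)) x = Q powr (\<mu> - 1/2) * S" .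
  have "(\<lambda>s. s powr (real n + real m + \<beta> + 2 * \<mu> + d - 1) * (1 - s) powr (\<gamma> + real n - real m))
      = (\<lambda>s. s powr (real N + a) * (1 - s) powr (real N + \<gamma>))"
    by (simp add: n a_def algebra_simps)
  then have time: "(deriv ^^ N) (\<lambda>s. s powr (real n + real m + \<beta> + 2 * \<mu> + d - 1) * (1 - s) powr (\<gamma> + real n - real m)) t
      = fact N * (t powr a * (1 - t) powr \<gamma> * shifted_jacobi a \<gamma> N t)"
    using shifted_jacobi_Rodrigues[OF t0 t] by simp
  have "t powr a = t powr \<beta> * t powr (2 * real m + 2 * \<mu> + d - 1)"
    by (simp add: a_def algebra_simps flip: powr_add)
  then have "1 / (Q powr (\<mu> - 1/2) * t powr \<beta> * (1 - t) powr \<gamma>) * (1 / t powr (2 * real m + 2 * \<mu> + d - 1))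
        * (Q powr (\<mu> - 1/2) * S) * (fact N * (t powr a * (1 - t) powr \<gamma> * shifted_jacobi a \<gamma> N t))
      = S * (fact N * shifted_jacobi a \<gamma> N t)"
    using Q t0 t by (simp add: field_simps)
  then show ?thesis
    unfolding UJ_formula_def UJ_poly_def Let_def cone_weight_def
    unfolding m_def[symmetric] N_def[symmetric] d_def[symmetric] Q_def[symmetric] fst_conv snd_conv
    unfolding space time a_def[symmetric] S_def[symmetric] Q_def[symmetric] .
qed

section \<open>Polynomiality, and uniqueness of the extension to the boundary\<close>

lemma real_polynomial_function_coeff_mult:
  assumes "\<And>L. real_polynomial_function (\<lambda>z. coeff (p z) L)"
    and "\<And>L. real_polynomial_function (\<lambda>z. coeff (q z) L)"
  shows "real_polynomial_function (\<lambda>z. coeff (p z * q z) L)"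
  unfolding coeff_mult using assms by (intro real_polynomial_function_sum real_polynomial_function.intros(4)) auto

lemma real_polynomial_function_coeff_prod:
  assumes "\<And>i L. i \<in> I \<Longrightarrow> real_polynomial_function (\<lambda>z. coeff (p i z) L)"
  shows "real_polynomial_function (\<lambda>z. coeff (\<Prod>i\<in>I. p i z) L)"
  using assms
proof (induction I arbitrary: L rule: infinite_finite_induct)
  case (insert i I)
  then show ?case
    by (simp add: real_polynomial_function_coeff_mult)
qed (simp_all add: real_polynomial_function.intros(2))

lemma real_polynomial_function_coeff_hermite_poly:
  assumes f: "real_polynomial_function f"
  shows "real_polynomial_function (\<lambda>z. coeff (hermite_poly n (f z)) L)"
proof -
  have m: "real_polynomial_function (\<lambda>z. coeff (monom (- 2 * f z) 1) L)" for L
    using f by (cases "L = 1") (auto intro!: real_polynomial_function_minus)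
  show ?thesis
  \<comment> \<open>The recursion runs on n alone; the value 0 merely fills the second argument of
    the induction rule.\<close>
  proof (induction n "0::real" arbitrary: L rule: hermite_poly.induct)
    case 1
    show ?case
      by (simp add: real_polynomial_function.intros(2))
  next
    case 2
    show ?case
      using m by simp
  next
    case (3 n)
    show ?case
      unfolding hermite_poly.simps coeff_add using 3 m
      by (intro real_polynomial_function.intros(3) real_polynomial_function_coeff_mult real_polynomial_function.intros(2))
  qed
qed

lemma real_polynomial_function_UJ_poly:
  "real_polynomial_function (UJ_poly \<beta> \<gamma> \<mu> k n :: (real^'d::finite) \<times> real \<Rightarrow> real)"
proof -
  have comp: "real_polynomial_function (\<lambda>z :: (real^'d) \<times> real. fst z $ i)" for i
    by (intro real_polynomial_function.intros(1) bounded_linear_compose[OF bounded_linear_vec_nth bounded_linear_fst])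
  have snd: "real_polynomial_function (\<lambda>z :: (real^'d) \<times> real. snd z)"
    by (intro real_polynomial_function.intros(1) bounded_linear_snd)
  have "(\<lambda>z :: (real^'d) \<times> real. (norm (fst z))\<^sup>2) = (\<lambda>z. \<Sum>i\<in>UNIV. fst z $ i * fst z $ i)"
    by (simp add: power2_norm_eq_inner inner_vec_def)
  then have norm: "real_polynomial_function (\<lambda>z :: (real^'d) \<times> real. (norm (fst z))\<^sup>2)"
    using comp by (auto intro!: real_polynomial_function_sum real_polynomial_function.intros(4))
  show ?thesis
    unfolding UJ_poly_def shifted_jacobi_def
    by (intro real_polynomial_function_sum real_polynomial_function.intros(4) real_polynomial_function.intros(2)
        real_polynomial_function_power real_polynomial_function_diff real_polynomial_function_minus
        real_polynomial_function_coeff_prod real_polynomial_function_coeff_hermite_poly comp snd norm) auto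
qed

text \<open>On the line through z0 and z the difference is a polynomial in one variable that
  vanishes on an interval.\<close>

lemma real_polynomial_function_eq_on_open:
  fixes p q :: "'a::real_normed_vector \<Rightarrow> real"
  assumes p: "real_polynomial_function p" and q: "real_polynomial_function q"
    and S: "open S" "z0 \<in> S" and eq: "\<And>z. z \<in> S \<Longrightarrow> p z = q z"
  shows "p = q"
proof
  fix z
  define line where "line = (\<lambda>s :: real. z0 + s *\<^sub>R (z - z0))"
  have line: "polynomial_function line"
    unfolding line_def by (intro polynomial_function_add polynomial_function_mult) auto
  have "real_polynomial_function (\<lambda>z. p z - q z)"
    using p q by (rule real_polynomial_function_diff)
  then have "real_polynomial_function ((\<lambda>z. p z - q z) \<circ> line)"
    by (rule real_polynomial_function_compose[OF line])
  then obtain a n where a: "(\<lambda>z. p z - q z) \<circ> line = (\<lambda>s. \<Sum>i\<le>n. a i * s ^ i)"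
    unfolding real_polynomial_function_iff_sum by blast
  have "(line \<longlongrightarrow> line 0) (nhds 0)"
    unfolding line_def by (intro tendsto_intros filterlim_ident)
  then have "eventually (\<lambda>s. line s \<in> S) (nhds 0)"
    using S by (auto simp: line_def elim: topological_tendstoD)
  then obtain e where e: "e > 0" "\<And>s. \<bar>s\<bar> < e \<Longrightarrow> line s \<in> S"
    unfolding eventually_nhds_metric by (auto simp: dist_real_def)
  have "{0<..<e} \<subseteq> {s. (\<Sum>i\<le>n. a i * s ^ i) = 0}"
  proof
    fix s
    assume "s \<in> {0<..<e}"
    then have "p (line s) = q (line s)"
      using e(2)[of s] eq by simp
    then show "s \<in> {s. (\<Sum>i\<le>n. a i * s ^ i) = 0}"
      using fun_cong[OF a, of s] by simp
  qed
  moreover have "infinite {0<..<e}"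
    using e(1) by simp
  ultimately have "infinite {s. (\<Sum>i\<le>n. a i * s ^ i) = 0}"
    using finite_subset by blast
  then have "\<forall>i\<le>n. a i = 0"
    using polyfun_finite_roots[of a n] by auto
  then show "p z = q z"
    using fun_cong[OF a, of 1] by (simp add: line_def)
qed

text \<open>Agreement on the nonempty open set norm x < t < 1 determines the polynomial, so the
  closed form is available on the whole cone, boundary included.\<close>

lemma UJ_eq_UJ_poly:
  fixes k :: "'d::finite \<Rightarrow> nat"
  assumes "mi_abs k \<le> n"
  shows "UJ \<beta> \<gamma> \<mu> k n = UJ_poly \<beta> \<gamma> \<mu> k n"
  unfolding UJ_def
proof (rule the_equality)
  show "real_polynomial_function (UJ_poly \<beta> \<gamma> \<mu> k n) \<and>
      (\<forall>x t. norm x < t \<and> t < 1 \<longrightarrow> UJ_poly \<beta> \<gamma> \<mu> k n (x, t) = UJ_formula \<beta> \<gamma> \<mu> k n x t)"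
    using UJ_formula_eq_poly[OF assms] by (auto simp: real_polynomial_function_UJ_poly)
next
  fix p :: "(real^'d) \<times> real \<Rightarrow> real"
  assume p: "real_polynomial_function p \<and> (\<forall>x t. norm x < t \<and> t < 1 \<longrightarrow> p (x, t) = UJ_formula \<beta> \<gamma> \<mu> k n x t)"
  let ?S = "{z :: (real^'d) \<times> real. norm (fst z) < snd z} \<inter> {z. snd z < 1}"
  show "p = UJ_poly \<beta> \<gamma> \<mu> k n"
  proof (rule real_polynomial_function_eq_on_open)
    show "open ?S"
      by (intro open_Int open_Collect_less continuous_intros)
    show "(0, 1/2) \<in> ?S"
      by simp
    show "p z = UJ_poly \<beta> \<gamma> \<mu> k n z" if "z \<in> ?S" for z
      using p that UJ_formula_eq_poly[OF assms] by (cases z) auto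
  qed (use p real_polynomial_function_UJ_poly in auto)
qed

lemma finite_mi_abs_le: "finite {k :: 'd::finite \<Rightarrow> nat. mi_abs k \<le> n}"
proof (rule finite_subset)
  have "k i \<le> mi_abs k" for k :: "'d \<Rightarrow> nat" and i
    unfolding mi_abs_def by (rule member_le_sum) auto
  then have "k \<in> PiE UNIV (\<lambda>_. {..n})" if "mi_abs k \<le> n" for k :: "'d \<Rightarrow> nat"
    using that by (auto intro: order_trans)
  then show "{k :: 'd \<Rightarrow> nat. mi_abs k \<le> n} \<subseteq> PiE UNIV (\<lambda>_. {..n})"
    by blast
qed (simp add: finite_PiE)

text \<open>The Jacobi factor depends on k only through m, and its factorial cancels. The ball
  factor is linear in the coefficients of the Hermite product, so the sum over k can be carried out
  inside \<open>coeff\<close>, before Z is decoded.\<close>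

lemma sum_UJ_degree:
  fixes b x :: "real^'d::finite"
  assumes \<mu>: "\<mu> > - 1/2" and m: "m \<le> n"
  shows "(\<Sum>k | mi_abs k = m. (-1) ^ mi_abs k * pochhammer (2 * \<mu>) (mi_abs k)
            / (2 ^ mi_abs k * pochhammer (\<mu> + 1/2) (mi_abs k) * mi_fact k * fact (n - mi_abs k))
            * UJ \<beta> \<gamma> \<mu> k n (x, t) * mi_power b k)
       = gegen_coeff (b \<bullet> x) ((norm b)\<^sup>2 * (t\<^sup>2 - (norm x)\<^sup>2)) \<mu> m
         * shifted_jacobi (2 * \<mu> + \<beta> + real CARD('d) - 1 + 2 * real m) \<gamma> (n - m) t"
proof -
  define Q where "Q = t\<^sup>2 - (norm x)\<^sup>2"
  define w where "w = (\<lambda>L. fact L * ((real m + \<mu> - 1/2) gchoose L) * Q ^ (m - L))"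
  define J where "J = shifted_jacobi (2 * \<mu> + \<beta> + real CARD('d) - 1 + 2 * real m) \<gamma> (n - m) t"
  define C where "C = (- 1) ^ m * pochhammer (2 * \<mu>) m / (2 ^ m * pochhammer (\<mu> + 1/2) m)"
  define P where "P = (\<lambda>k :: 'd \<Rightarrow> nat. \<Prod>i\<in>UNIV. hermite_poly (k i) (x $ i))"
  define e where "e = (\<lambda>j. (- 2 * (b \<bullet> x)) ^ (m - 2 * j) * (- ((norm b)\<^sup>2)) ^ j / (fact j * fact (m - 2 * j)))"
  have "(\<Sum>k | mi_abs k = m. (-1) ^ mi_abs k * pochhammer (2 * \<mu>) (mi_abs k)
            / (2 ^ mi_abs k * pochhammer (\<mu> + 1/2) (mi_abs k) * mi_fact k * fact (n - mi_abs k))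
            * UJ \<beta> \<gamma> \<mu> k n (x, t) * mi_power b k)
      = (\<Sum>k | mi_abs k = m. C * J * (mi_power b k / mi_fact k * (\<Sum>L\<le>m. coeff (P k) L * w L)))"
  proof (intro sum.cong refl)
    fix k :: "'d \<Rightarrow> nat"
    assume "k \<in> {k. mi_abs k = m}"
    then have k: "mi_abs k = m"
      by simp
    have UJ: "UJ \<beta> \<gamma> \<mu> k n (x, t) = (\<Sum>L\<le>m. coeff (P k) L * w L) * (fact (n - m) * J)"
      using m by (simp only: UJ_eq_UJ_poly k UJ_poly_def fst_conv snd_conv w_def J_def P_def Q_def)
    have cancel: "A / (B * E * f) * (S * (f * J)) * y = A / B * J * (y / E * S)"
      if "f \<noteq> 0" for A B E f S y :: real
      using that by (simp add: field_simps)
    show "(-1) ^ mi_abs k * pochhammer (2 * \<mu>) (mi_abs k)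
            / (2 ^ mi_abs k * pochhammer (\<mu> + 1/2) (mi_abs k) * mi_fact k * fact (n - mi_abs k))
            * UJ \<beta> \<gamma> \<mu> k n (x, t) * mi_power b k
        = C * J * (mi_power b k / mi_fact k * (\<Sum>L\<le>m. coeff (P k) L * w L))"
      unfolding UJ k C_def by (rule cancel) simp
  qed
  also have "\<dots> = C * J * (\<Sum>k | mi_abs k = m. \<Sum>L\<le>m. mi_power b k / mi_fact k * coeff (P k) L * w L)"
    by (simp only: sum_distrib_left mult.assoc)
  also have "(\<Sum>k | mi_abs k = m. \<Sum>L\<le>m. mi_power b k / mi_fact k * coeff (P k) L * w L)
      = (\<Sum>L\<le>m. coeff (\<Sum>k | mi_abs k = m. smult (mi_power b k / mi_fact k) (P k)) L * w L)"
    by (subst sum.swap) (simp add: coeff_sum sum_distrib_right)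
  also have "\<dots> = (\<Sum>L\<le>m. coeff (\<Sum>j\<le>m div 2. monom (e j) (m - j)) L * w L)"
    unfolding P_def hermite_poly_multinomial_sum e_def ..
  \<comment> \<open>Each j contributes only to L = m - j, so the power m - L of Q becomes j.\<close>
  also have "\<dots> = (\<Sum>L\<le>m. \<Sum>j\<le>m div 2. (if m - j = L then e j * w L else 0))"
    unfolding coeff_sum sum_distrib_right by (intro sum.cong refl) simp
  also have "\<dots> = (\<Sum>j\<le>m div 2. e j * w (m - j))"
    by (subst sum.swap) (simp add: sum.delta)
  also have "\<dots> = (\<Sum>j\<le>m div 2. e j * (fact (m - j) * ((real m + \<mu> - 1/2) gchoose (m - j)) * Q ^ j))"
    by (intro sum.cong refl) (auto simp: w_def)
  also have "C * J * \<dots> = gegen_coeff (b \<bullet> x) ((norm b)\<^sup>2 * Q) \<mu> m * J"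
    unfolding gegen_coeff_identity[OF \<mu>, symmetric] C_def e_def by (simp add: mult_ac)
  finally show ?thesis
    unfolding J_def Q_def .
qed

theorem proposition5p3:
  fixes \<mu> \<beta> \<gamma> r t R d :: real and b x :: "real^'d::finite"
  assumes "d = real CARD('d)"
    and "\<mu> > -1/2" and "\<beta> > -d" and "\<gamma> > -1" and "2 * \<mu> + \<beta> + d > 0"
    and "b \<in> cball 0 1" and "0 < r" and "r < 1" and "(x, t) \<in> solid_cone"
    and "R = sqrt ((1 - r)\<^sup>2 + 4 * r * t)"
  shows "(\<lambda>n. \<Sum>k | mi_abs k \<le> n.
            (-1) ^ mi_abs k * pochhammer (2 * \<mu>) (mi_abs k)
            / (2 ^ mi_abs k * pochhammer (\<mu> + 1/2) (mi_abs k) * mi_fact k * fact (n - mi_abs k))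
            * UJ \<beta> \<gamma> \<mu> k n (x, t) * mi_power b k * r ^ n)
         sums
         (2 powr (2 * \<mu> + \<beta> + \<gamma> + d - 1) * (1 / R) * (1 + r + R) powr (-\<gamma>)
            * (1 - r + R) powr (2 * \<mu> - \<beta> - d + 1)
          / ((((1 - r + R)\<^sup>2 - 4 * r * (b \<bullet> x))\<^sup>2
              + 16 * r\<^sup>2 * (norm b)\<^sup>2 * (t\<^sup>2 - (norm x)\<^sup>2)) powr \<mu>))"
proof -
  define a where "a = 2 * \<mu> + \<beta> + d - 1"
  define c where "c = b \<bullet> x"
  define D where "D = (norm b)\<^sup>2 * (t\<^sup>2 - (norm x)\<^sup>2)"
  define p where "p = 1 - r + R"
  define s where "s = 4 * r / p\<^sup>2"
  have x: "norm x \<le> t" and t: "0 \<le> t" "t \<le> 1"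
    using assms(9) by (auto simp: solid_cone_def)
  have "(norm x)\<^sup>2 \<le> t\<^sup>2"
    using x by (intro power_mono) auto
  then have Q: "0 \<le> t\<^sup>2 - (norm x)\<^sup>2"
    by simp
  then have D: "0 \<le> D"
    by (simp add: D_def)
  have "(norm b)\<^sup>2 \<le> 1"
    using assms(6) by (simp add: abs_square_le_1)
  then have b: "(norm b)\<^sup>2 * t\<^sup>2 \<le> t\<^sup>2"
    by (intro mult_left_le_one_le) auto
  have "c\<^sup>2 \<le> (norm b)\<^sup>2 * (norm x)\<^sup>2"
    unfolding c_def power2_norm_eq_inner by (rule Cauchy_Schwarz_ineq)
  \<comment> \<open>The terms in |x|^2 cancel: c^2 + D \<le> |b|^2 t^2 \<le> t^2.\<close>
  with b have cD: "c\<^sup>2 + D \<le> t\<^sup>2"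
    by (simp add: D_def algebra_simps)
  have R: "0 < R"
    using assms(7,8) t by (simp add: assms(10) add_pos_nonneg)
  have p: "0 < p"
    using assms(8) R by (simp add: p_def)
  note gf = generating_function_real[OF t D cD assms(7,8), folded assms(10), folded p_def, folded s_def]
  have terms: "(\<Sum>k | mi_abs k \<le> n.
            (-1) ^ mi_abs k * pochhammer (2 * \<mu>) (mi_abs k)
            / (2 ^ mi_abs k * pochhammer (\<mu> + 1/2) (mi_abs k) * mi_fact k * fact (n - mi_abs k))
            * UJ \<beta> \<gamma> \<mu> k n (x, t) * mi_power b k * r ^ n)
      = (\<Sum>m\<le>n. gegen_coeff c D \<mu> m * shifted_jacobi (a + 2 * real m) \<gamma> (n - m) t) * r ^ n" (is "sum ?h ?K = _") for n
  proof -
    have "sum ?h ?K = (\<Sum>m\<le>n. sum ?h {k. k \<in> ?K \<and> mi_abs k = m})"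
      by (intro sum.group[symmetric] finite_mi_abs_le) auto
    also have "\<dots> = (\<Sum>m\<le>n. sum ?h {k. mi_abs k = m})"
      by (intro sum.cong refl) auto
    also have "\<dots> = (\<Sum>m\<le>n. gegen_coeff c D \<mu> m * shifted_jacobi (a + 2 * real m) \<gamma> (n - m) t * r ^ n)"
    proof (intro sum.cong refl)
      fix m
      assume "m \<in> {..n}"
      then have m: "m \<le> n"
        by simp
      show "sum ?h {k. mi_abs k = m} = gegen_coeff c D \<mu> m * shifted_jacobi (a + 2 * real m) \<gamma> (n - m) t * r ^ n"
        unfolding sum_distrib_right[symmetric] sum_UJ_degree[OF assms(2) m] a_def c_def D_def assms(1) ..
    qed
    finally show ?thesis
      by (simp only: sum_distrib_right)
  qed
  define X where "X = (p\<^sup>2 - 4 * r * c)\<^sup>2 + 16 * r\<^sup>2 * D"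
  \<comment> \<open>Multiplying by p^4 clears the denominators of s = 4r / p^2. The resulting p powr
    (4\<mu>) later turns the exponent -a of p into 2\<mu> - \<beta> - d + 1.\<close>
  have Xs: "X = p powr 4 * ((1 - c * s)\<^sup>2 + D * s\<^sup>2)"
    using p by (simp add: X_def s_def field_simps power2_eq_square power4_eq_xxxx)
  have pos: "0 < (1 - c * s)\<^sup>2 + D * s\<^sup>2"
    using gf(2) D by (intro add_pos_nonneg) auto
  have "X powr (- \<mu>) = p powr (- 4 * \<mu>) * ((1 - c * s)\<^sup>2 + D * s\<^sup>2) powr (- \<mu>)"
    unfolding Xs using pos by (subst powr_mult) (simp_all add: powr_powr del: powr_numeral)
  then have X: "((1 - c * s)\<^sup>2 + D * s\<^sup>2) powr (- \<mu>) = p powr (4 * \<mu>) / X powr \<mu>"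
    using p by (simp add: powr_minus field_simps)
  have "(2 / p) powr a * (2 / (1 + r + R)) powr \<gamma> / R * (p powr (4 * \<mu>) / X powr \<mu>)
      = (2 powr a * 2 powr \<gamma>) * (1 / R) * (1 + r + R) powr (- \<gamma>) * (p powr (- a) * p powr (4 * \<mu>)) / X powr \<mu>"
    using p R assms(7) by (simp add: powr_divide powr_minus field_simps)
  also have "2 powr a * 2 powr \<gamma> = 2 powr (2 * \<mu> + \<beta> + \<gamma> + d - 1)"
    by (simp add: a_def algebra_simps flip: powr_add)
  also have "p powr (- a) * p powr (4 * \<mu>) = p powr (2 * \<mu> - \<beta> - d + 1)"
    by (simp add: a_def algebra_simps flip: powr_add)
  finally have "(2 / p) powr a * (2 / (1 + r + R)) powr \<gamma> / R * ((1 - c * s)\<^sup>2 + D * s\<^sup>2) powr (- \<mu>)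
      = 2 powr (2 * \<mu> + \<beta> + \<gamma> + d - 1) * (1 / R) * (1 + r + R) powr (-\<gamma>)
            * p powr (2 * \<mu> - \<beta> - d + 1) / X powr \<mu>"
    unfolding X .
  with gf(1)[of \<mu> a \<gamma>] show ?thesis
    unfolding terms X_def p_def c_def D_def by (simp only: mult.assoc)
qed

end
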